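(* The period lattice $\Lambda$ of $\Psi$ equals $\xi_{\mathcal A}\cdot\mathcal A$, where the Carlitz period $\xi_{\mathcal A}$ is given by \[ \xi_{\mathcal A}=\frac{\sqrt[q-1]{-[2]}\;T^{\sigma-1}}{[1]}\cdot\prod_{i=1}^\infty\Big(1-\frac{[i]}{[i+2]}\Big), \] with $\sqrt[q-1]{-[2]}$ a $(q-1)$-th root of $-[2]$.
   Context: Let $q$ be a prime power, $\zeta\in\mathbb F_{q^2}\setminus\mathbb F_q$, $\pi(t)=(t-\zeta)(t-\zeta^q)$, $K=\mathbb F_q(t)$, $x=1/\pi$, $y=t/\pi$, $\mathcal A=\mathbb F_q[x,y]$. $T=1/(t-\zeta^q)$, $T^\sigma=1/(t-\zeta)$, $T^{a+b\sigma}:=T^a(T^\sigma)^b$; for $k\ge1$, $[2k]=T^{q^{2k}}-T$, $[2k-1]=T^{q^{2k-1}}-T^\sigma$. $\mathbb C_\infty$ is the completion of an algebraic closure of $\mathbb F_{q^2}((1/T))$ w.r.t. the $1/T$-adic valuation, with $K$ embedded via $t=\zeta^q+1/T$. $\Psi$ is the rank one Drinfeld module over $\mathbb C_\infty$ with \[ \Psi_x=T^{\sigma-1}\tau^2+(T^\sigma+T^{q-1+\sigma})\tau+x,\qquad \Psi_y=\zeta T^{\sigma-1}\tau^2+(tT^\sigma+\zeta T^{q-1+\sigma})\tau+y \] ($\tau$ the $q$-Frobenius). Its exponential $\exp_\Lambda$ is the unique entire $\mathbb F_q$-linear series $X+\sum_{j\ge1}c_jX^{q^j}$ with $\Psi_a(\exp_\Lambda(X))=\exp_\Lambda(aX)$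 for all $a\in\mathcal A$; its kernel $\Lambda\subset\mathbb C_\infty$ is the period lattice, a rank one $\mathcal A$-lattice. *)

theory Defs
  imports
    "HOL-Analysis.Analysis"
    "HOL-Algebra.Algebraic_Closure_Type"
    "HOL-Number_Theory.Prime_Powers"
begin

text \<open>
  The completion of an algebraic closure of the field of Laurent series \<open>'f fls\<close> over a finite
  field \<open>'f\<close> with respect to the (unique) extension of the valuation \<open>fls_subdegree\<close>; it is
  determined up to isometric isomorphism. Completeness is part of the sort of \<open>'c\<close>.
  The absolute value of \<open>z\<close> is \<open>dist z 0\<close> (the class \<open>real_normed_field\<close> is not available in
  positive characteristic), normalised so that the inverse of the uniformiser \<open>fls_X\<close> has absolute
  value the cardinality of the residue field.
\<close>

definition completed_alg_closure ::
    "('f::{field,finite} fls alg_closure \<Rightarrow> 'c::{field,complete_space}) \<Rightarrow> bool"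
  where "completed_alg_closure \<iota> \<longleftrightarrow>
    \<iota> 1 = 1 \<and>
    (\<forall>u v. \<iota> (u + v) = \<iota> u + \<iota> v) \<and>
    (\<forall>u v. \<iota> (u * v) = \<iota> u * \<iota> v) \<and>
    (\<forall>z w :: 'c. dist z w = dist (z - w) 0) \<and>
    (\<forall>z w :: 'c. dist (z * w) 0 = dist z 0 * dist w 0) \<and>
    (\<forall>z w :: 'c. dist (z + w) 0 \<le> max (dist z 0) (dist w 0)) \<and>
    (\<forall>f. f \<noteq> 0 \<longrightarrow> dist (\<iota> (to_ac f)) 0 = real CARD('f) powi (- fls_subdegree f)) \<and>
    closure (range \<iota>) = UNIV"

definition of_const :: "('f::{field,finite} fls alg_closure \<Rightarrow> 'c) \<Rightarrow> 'f \<Rightarrow> 'c"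
  where "of_const \<iota> a = \<iota> (to_ac (fls_const a))"

text \<open>The subfield with \<open>q\<close> elements of a field containing one.\<close>

definition Fq :: "nat \<Rightarrow> 'a::field set"
  where "Fq q = {a. a ^ q = a}"

inductive_set Fq_algebra :: "nat \<Rightarrow> 'a::field set \<Rightarrow> 'a set"
  for q :: nat and S :: "'a set"
where
  const: "a \<in> Fq q \<Longrightarrow> a \<in> Fq_algebra q S"
| gen: "s \<in> S \<Longrightarrow> s \<in> Fq_algebra q S"
| add: "a \<in> Fq_algebra q S \<Longrightarrow> b \<in> Fq_algebra q S \<Longrightarrow> a + b \<in> Fq_algebra q S"
| mult: "a \<in> Fq_algebra q S \<Longrightarrow> b \<in> Fq_algebra q S \<Longrightarrow> a * b \<in> Fq_algebra q S"

text \<open>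
  Twisted polynomials in the \<open>q\<close>-Frobenius \<open>\<tau>\<close> are represented by their coefficients: the
  polynomial \<open>f\<close> stands for \<open>\<Sum>i. coeff f i * \<tau>^i\<close>. Addition is that of ordinary polynomials;
  multiplication is governed by \<open>\<tau> * b = b^q * \<tau>\<close>.
\<close>

definition twisted_mult :: "nat \<Rightarrow> 'a::field poly \<Rightarrow> 'a poly \<Rightarrow> 'a poly"
  where "twisted_mult q f g =
    (\<Sum>i\<le>Polynomial.degree f. \<Sum>j\<le>Polynomial.degree g.
       Polynomial.monom (poly.coeff f i * poly.coeff g j ^ (q ^ i)) (i + j))"

definition twisted_eval :: "nat \<Rightarrow> 'a::field poly \<Rightarrow> 'a \<Rightarrow> 'a"
  where "twisted_eval q f z = (\<Sum>i\<le>Polynomial.degree f. poly.coeff f i * z ^ (q ^ i))"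

text \<open>
  The values of \<open>\<Psi>\<close> outside \<open>A\<close> are irrelevant.
\<close>

definition drinfeld_module :: "nat \<Rightarrow> 'a::field set \<Rightarrow> ('a \<Rightarrow> 'a poly) \<Rightarrow> bool"
  where "drinfeld_module q A \<Psi> \<longleftrightarrow>
    (\<forall>a\<in>Fq q. \<Psi> a = [:a:]) \<and>
    (\<forall>a\<in>A. \<forall>b\<in>A. \<Psi> (a + b) = \<Psi> a + \<Psi> b \<and> \<Psi> (a * b) = twisted_mult q (\<Psi> a) (\<Psi> b)) \<and>
    (\<forall>a\<in>A. poly.coeff (\<Psi> a) 0 = a) \<and>
    (\<exists>a\<in>A. \<Psi> a \<noteq> [:a:])"

text \<open>
  A Drinfeld module has rank \<open>r\<close> if the \<open>\<tau>\<close>-degree of \<open>\<Psi> a\<close> is \<open>r * deg a\<close> for all nonzero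
  \<open>a \<in> A\<close>, where \<open>q ^ deg a\<close> is the cardinality of \<open>A/aA\<close>. In the situation at hand, the residue
  field at infinity has \<open>q^2\<close> elements, and with the normalisation in
  \<open>completed_alg_closure\<close> one has \<open>q ^ deg a = dist a 0\<close>.
\<close>

definition drinfeld_rank ::
    "nat \<Rightarrow> 'a::{field,metric_space} set \<Rightarrow> ('a \<Rightarrow> 'a poly) \<Rightarrow> nat \<Rightarrow> bool"
  where "drinfeld_rank q A \<Psi> r \<longleftrightarrow>
    (\<forall>a\<in>A. a \<noteq> 0 \<longrightarrow> real (q ^ Polynomial.degree (\<Psi> a)) = dist a 0 ^ r)"

definition Fq_linear_series :: "nat \<Rightarrow> (nat \<Rightarrow> 'a::{field,metric_space}) \<Rightarrow> 'a \<Rightarrow> 'a"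
  where "Fq_linear_series q c z = (\<Sum>j. c j * z ^ (q ^ j))"

definition drinfeld_exponential ::
    "nat \<Rightarrow> 'a::{field,metric_space} set \<Rightarrow> ('a \<Rightarrow> 'a poly) \<Rightarrow> (nat \<Rightarrow> 'a) \<Rightarrow> bool"
  where "drinfeld_exponential q A \<Psi> c \<longleftrightarrow>
    c 0 = 1 \<and>
    (\<forall>z. summable (\<lambda>j. c j * z ^ (q ^ j))) \<and>
    (\<forall>a\<in>A. \<forall>z. twisted_eval q (\<Psi> a) (Fq_linear_series q c z) = Fq_linear_series q c (a * z))"

definition period_lattice :: "nat \<Rightarrow> (nat \<Rightarrow> 'a::{field,metric_space}) \<Rightarrow> 'a set"
  where "period_lattice q c = {z. Fq_linear_series q c z = 0}"

text \<open>The symbol \<open>[k]\<close>, for \<open>k \<ge> 1\<close>; the argument \<open>Ts\<close> is the conjugate of \<open>T\<close>.\<close>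

definition bracket :: "nat \<Rightarrow> 'a::field \<Rightarrow> 'a \<Rightarrow> nat \<Rightarrow> 'a"
  where "bracket q T Ts k = T ^ (q ^ k) - (if even k then T else Ts)"

end

theory Submission
  imports Defs "HOL-Number_Theory.Residues"
begin

text \<open>
  Write \<open>t\<^sub>i = t ^ q ^ i\<close> and \<open>\<pi>(v) = (v - \<zeta>) (v - \<zeta>\<^sup>q)\<close>. Since \<open>\<Psi>\<^sub>y - \<zeta> \<Psi>\<^sub>x = T + \<tau>\<close>, the
  coefficients of the exponential satisfy a two-term recurrence. The same recurrence, up to a
  factor tending to \<open>1\<close>, relates the summands \<open>\<pi>(t\<^sub>i) ^ n / (\<Prod>k\<noteq>i. t\<^sub>i - t\<^sub>k)\<close> of the divided
  difference of \<open>\<pi> ^ n\<close> at \<open>t\<^sub>0, \<dots>, t\<^bsub>2 n + 1\<^esub>\<close>, which vanishes because \<open>\<pi> ^ n\<close> has degree \<open>2 n\<close>.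
  Normalised by the summand with \<open>i = 0\<close>, the summands tend to the terms of \<open>exp(\<xi>) / \<xi>\<close>, with
  equal absolute values, so \<open>exp(\<xi>) = 0\<close>; the product formula for \<open>\<xi>\<close> is the limit of the
  summand with \<open>i = 0\<close>.

  Conversely, the sizes of the coefficients show that the periods of absolute value at most that
  of \<open>\<xi>\<close> are the \<open>F\<^sub>q\<close>-multiples of \<open>\<xi>\<close>. As \<open>\<Psi>\<^sub>x\<close> has at most \<open>q\<^sup>2\<close> roots, every period is of the
  form \<open>\<xi> (\<alpha> + \<beta> y) + x w\<close> with \<open>\<alpha>, \<beta>\<close> in \<open>F\<^sub>q\<close> and a smaller period \<open>w\<close>, and descent on the
  absolute value concludes.
\<close>

section \<open>Complete ultrametric fields\<close>

locale ultrametric_field =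
  fixes N :: "'c::{field,complete_space} \<Rightarrow> real"
  assumes dist_eq: "dist z w = N (z - w)"
    and N_mult: "N (z * w) = N z * N w"
    and N_add_le: "N (z + w) \<le> max (N z) (N w)"
begin

lemma N_eq_dist: "N z = dist z 0"
  by (simp add: dist_eq)

lemma N_nonneg [simp]: "0 \<le> N z"
  by (simp add: N_eq_dist)

lemma N_0 [simp]: "N 0 = 0"
  by (simp add: N_eq_dist)

lemma N_eq_0 [simp]: "N z = 0 \<longleftrightarrow> z = 0"
  by (simp add: N_eq_dist)

lemma N_pos [simp]: "0 < N z \<longleftrightarrow> z \<noteq> 0"
  by (metis N_eq_0 N_nonneg less_le)

lemma N_1 [simp]: "N 1 = 1"
  using N_mult[of 1 1] by simp

lemma N_power: "N (z ^ n) = N z ^ n"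
  by (induction n) (auto simp: N_mult)

lemma N_prod: "N (prod f I) = (\<Prod>i\<in>I. N (f i))"
  by (induction I rule: infinite_finite_induct) (auto simp: N_mult)

lemma N_minus [simp]: "N (- z) = N z"
proof -
  have "N (- z) = dist 0 z"
    by (simp add: dist_eq)
  also have "\<dots> = N z"
    by (subst dist_commute) (simp add: dist_eq)
  finally show ?thesis .
qed

lemma N_diff_commute: "N (z - w) = N (w - z)"
  using N_minus[of "z - w"] by simp

lemma N_diff_le: "N (z - w) \<le> max (N z) (N w)"
  using N_add_le[of z "- w"] by simp

lemma N_divide: "N (z / w) = N z / N w"
proof (cases "w = 0")
  case False
  then have "N (z / w) * N w = N z"
    by (simp flip: N_mult)
  then show ?thesis
    using False by (simp add: field_simps)
qed auto

text \<open>As \<open>w = (z + w) - z\<close>, a larger \<open>w\<close> cannot be cancelled by a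
  smaller \<open>z\<close>.\<close>

lemma N_add_eq: "N z < N w \<Longrightarrow> N (z + w) = N w"
  using N_add_le[of z w] N_diff_le[of "z + w" z] by auto

lemma N_diff_eq: "N z < N w \<Longrightarrow> N (z - w) = N w"
  using N_add_eq[of z "- w"] by simp

lemma N_diff_eq': "N z < N w \<Longrightarrow> N (w - z) = N w"
  using N_diff_eq[of z w] N_diff_commute by metis

lemma N_sum_le: "0 \<le> B \<Longrightarrow> (\<And>i. i \<in> I \<Longrightarrow> N (f i) \<le> B) \<Longrightarrow> N (sum f I) \<le> B"
proof (induction I rule: infinite_finite_induct)
  case (insert i I)
  then show ?case
    using N_add_le[of "f i" "sum f I"] by fastforce
qed auto

section \<open>Limits, series and infinite products in an ultrametric field\<close>

lemma tendsto_iff_N: "f \<longlonglongrightarrow> l \<longleftrightarrow> (\<lambda>n. N (f n - l)) \<longlonglongrightarrow> 0"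
  by (subst tendsto_dist_iff) (simp add: dist_eq)

lemma N_null_if_le:
  assumes "\<And>n. N (f n) \<le> h n" "h \<longlonglongrightarrow> 0"
  shows "(\<lambda>n. N (f n)) \<longlonglongrightarrow> 0"
  by (rule tendsto_sandwich[where f = "\<lambda>_. 0" and h = h]) (use assms in auto)

lemma tendsto_N: "f \<longlonglongrightarrow> l \<Longrightarrow> (\<lambda>n. N (f n)) \<longlonglongrightarrow> N l"
  unfolding N_eq_dist by (intro tendsto_intros)

lemma tendsto_add_N:
  fixes a b :: 'c
  assumes "f \<longlonglongrightarrow> a" "g \<longlonglongrightarrow> b"
  shows "(\<lambda>n. f n + g n) \<longlonglongrightarrow> a + b"
proof -
  have "(\<lambda>n. max (N (f n - a)) (N (g n - b))) \<longlonglongrightarrow> max 0 0"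
    using assms by (intro tendsto_max) (auto simp: tendsto_iff_N)
  then have lim: "(\<lambda>n. max (N (f n - a)) (N (g n - b))) \<longlonglongrightarrow> 0"
    by simp
  have le: "N (f n + g n - (a + b)) \<le> max (N (f n - a)) (N (g n - b))" for n
    using N_add_le[of "f n - a" "g n - b"] by (simp add: algebra_simps)
  show ?thesis
    unfolding tendsto_iff_N by (rule N_null_if_le[OF le lim])
qed

lemma tendsto_mult_N:
  fixes a b :: 'c
  assumes "f \<longlonglongrightarrow> a" "g \<longlonglongrightarrow> b"
  shows "(\<lambda>n. f n * g n) \<longlonglongrightarrow> a * b"
proof -
  let ?h = "\<lambda>n. max (N (f n - a) * N (g n)) (N a * N (g n - b))"
  have "?h \<longlonglongrightarrow> max (0 * N b) (N a * 0)"
    using assms by (intro tendsto_max tendsto_mult tendsto_N tendsto_const) (auto simp: tendsto_iff_N)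
  then have lim: "?h \<longlonglongrightarrow> 0"
    by simp
  have le: "N (f n * g n - a * b) \<le> ?h n" for n
    using N_add_le[of "(f n - a) * g n" "a * (g n - b)"] by (simp add: algebra_simps flip: N_mult)
  show ?thesis
    unfolding tendsto_iff_N by (rule N_null_if_le[OF le lim])
qed

lemma tendsto_power_N:
  fixes a :: 'c
  shows "f \<longlonglongrightarrow> a \<Longrightarrow> (\<lambda>n. f n ^ k) \<longlonglongrightarrow> a ^ k"
  by (induction k) (auto intro: tendsto_mult_N)

lemma tendsto_sum_N:
  fixes a :: "'b \<Rightarrow> 'c"
  shows "(\<And>i. i \<in> I \<Longrightarrow> (\<lambda>n. f i n) \<longlonglongrightarrow> a i) \<Longrightarrow> (\<lambda>n. \<Sum>i\<in>I. f i n) \<longlonglongrightarrow> (\<Sum>i\<in>I. a i)"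
  by (induction I rule: infinite_finite_induct) (auto intro: tendsto_add_N)

text \<open>A sum of steps is no larger than its largest step, so null steps already make the
  sequence Cauchy.\<close>

lemma convergent_if_steps_null:
  assumes "(\<lambda>n. N (f (Suc n) - f n)) \<longlonglongrightarrow> 0"
  shows "convergent f"
proof (intro Cauchy_convergent metric_CauchyI)
  fix e :: real
  assume "e > 0"
  then obtain M where M: "\<And>n. n \<ge> M \<Longrightarrow> N (f (Suc n) - f n) < e"
    using assms by (fastforce simp: lim_sequentially)
  have near: "N (f n - f M) < e" if "n \<ge> M" for n
    using that
  proof (induction n rule: dec_induct)
    case (step n)
    then show ?case
      using N_add_le[of "f (Suc n) - f n" "f n - f M"] M[of n] by auto
  qed (use \<open>e > 0\<close> in auto)
  have "dist (f m) (f n) < e" if "m \<ge> M" "n \<ge> M" for m n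
    using N_diff_le[of "f m - f M" "f n - f M"] near[of m] near[of n] that by (auto simp: dist_eq)
  then show "\<exists>M. \<forall>m\<ge>M. \<forall>n\<ge>M. dist (f m) (f n) < e"
    by blast
qed

lemma summable_imp_null:
  assumes "summable f"
  shows "(\<lambda>n. N (f n)) \<longlonglongrightarrow> 0"
proof -
  have lim: "(\<lambda>n. \<Sum>i<n. f i) \<longlonglongrightarrow> suminf f"
    using assms by (rule summable_LIMSEQ)
  have "(\<lambda>n. (\<Sum>i<Suc n. f i) + - 1 * (\<Sum>i<n. f i)) \<longlonglongrightarrow> suminf f + - 1 * suminf f"
    by (rule tendsto_add_N[OF LIMSEQ_Suc[OF lim] tendsto_mult_N[OF tendsto_const lim]])
  then show ?thesis
    by (simp add: tendsto_iff_N)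
qed

lemma sums_add_N:
  fixes a b :: 'c
  shows "f sums a \<Longrightarrow> g sums b \<Longrightarrow> (\<lambda>n. f n + g n) sums (a + b)"
  unfolding sums_def sum.distrib by (rule tendsto_add_N)

lemma sums_mult_N:
  fixes a :: 'c
  shows "f sums a \<Longrightarrow> (\<lambda>n. k * f n) sums (k * a)"
  unfolding sums_def by (subst sum_distrib_left[symmetric]) (intro tendsto_mult_N tendsto_const)

lemma sums_diff_N:
  fixes a b :: 'c
  shows "f sums a \<Longrightarrow> g sums b \<Longrightarrow> (\<lambda>n. f n - g n) sums (a - b)"
  using sums_add_N[of f a "\<lambda>n. - 1 * g n" "- 1 * b"] sums_mult_N[of g b "- 1"] by simp

lemma sums_tail_le:
  assumes "f sums s" "B \<ge> 0" "\<And>j. j \<ge> m \<Longrightarrow> N (f j) \<le> B"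
  shows "N (s - (\<Sum>j<m. f j)) \<le> B"
proof -
  have "(\<lambda>n. N ((\<Sum>j<n. f j) + - (\<Sum>j<m. f j))) \<longlonglongrightarrow> N (s + - (\<Sum>j<m. f j))"
    using tendsto_N[OF tendsto_add_N[OF _ tendsto_const]] assms(1) unfolding sums_def by blast
  moreover have "N ((\<Sum>j<n. f j) + - (\<Sum>j<m. f j)) \<le> B" if "n \<ge> m" for n
  proof -
    have "(\<Sum>j<n. f j) + - (\<Sum>j<m. f j) = (\<Sum>j\<in>{m..<n}. f j)"
      using that by (simp add: lessThan_atLeast0 sum_diff_nat_ivl)
    also have "N \<dots> \<le> B"
      using assms by (intro N_sum_le) auto
    finally show ?thesis .
  qed
  ultimately show ?thesis
    by (auto intro: LIMSEQ_le_const2)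
qed

text \<open>Since the terms tend to zero, a strict bound on each of them is a strict bound on the sum.\<close>
lemma sums_tail_less:
  assumes "f sums s" "B > 0" "\<And>j. j \<ge> m \<Longrightarrow> N (f j) < B"
  shows "N (s - (\<Sum>j<m. f j)) < B"
proof -
  have "(\<lambda>n. N (f n)) \<longlonglongrightarrow> 0"
    using assms(1) by (intro summable_imp_null sums_summable)
  then obtain M where M: "\<And>j. j \<ge> M \<Longrightarrow> N (f j) < B / 2"
    using \<open>B > 0\<close> by (fastforce simp: lim_sequentially dest: spec[of _ "B / 2"])
  \<comment> \<open>The finitely many terms before \<open>M\<close> have a maximum below
    \<open>B\<close>, and all later ones stay below \<open>B / 2\<close>.\<close>
  define C where "C = Max (insert (B / 2) ((\<lambda>j. N (f j)) ` {m..<M}))"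
  have "C < B"
    using assms by (auto simp: C_def)
  have "C \<ge> B / 2"
    unfolding C_def by (rule Max_ge) auto
  have "N (f j) \<le> C" if "j \<ge> m" for j
  proof (cases "j < M")
    case True
    then show ?thesis
      using that unfolding C_def by (intro Max_ge) auto
  next
    case False
    then show ?thesis
      using M[of j] \<open>C \<ge> B / 2\<close> by auto
  qed
  then have "N (s - (\<Sum>j<m. f j)) \<le> C"
    using assms \<open>C \<ge> B / 2\<close> by (intro sums_tail_le) auto
  then show ?thesis
    using \<open>C < B\<close> by simp
qed

text \<open>Every factor has size 1, so consecutive partial products differ exactly by the size of
  \<open>a n\<close>. The limit has size 1 as well; hence it is nonzero, as \<open>has_prod\<close>
  demands of a product without zero factors.\<close>

lemma has_prod_one_minus:
  assumes less: "\<And>i. N (a i) < 1" and null: "(\<lambda>i. N (a i)) \<longlonglongrightarrow> 0"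
  obtains P where "N P = 1" "(\<lambda>i. 1 - a i) has_prod P" "(\<lambda>n. \<Prod>i<n. 1 - a i) \<longlonglongrightarrow> P"
proof -
  let ?p = "\<lambda>n. \<Prod>i<n. 1 - a i"
  have N1: "N (1 - a i) = 1" for i
    using less[of i] N_diff_eq'[of "a i" 1] by simp
  have Np: "N (?p n) = 1" for n
    by (simp add: N_prod N1)
  have "?p (Suc n) - ?p n = - (?p n * a n)" for n
    by (simp add: algebra_simps)
  then have "N (?p (Suc n) - ?p n) = N (a n)" for n
    by (simp add: N_mult Np)
  then have "convergent ?p"
    using null by (intro convergent_if_steps_null) simp
  then obtain P where P: "?p \<longlonglongrightarrow> P"
    by (auto simp: convergent_def)
  have "N P = 1"
    using tendsto_N[OF P] by (simp add: Np LIMSEQ_const_iff)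
  moreover from this have "P \<noteq> 0"
    by auto
  then have "(\<lambda>i. 1 - a i) has_prod P"
    using LIMSEQ_Suc[OF P] by (simp add: has_prod_def raw_has_prod_def lessThan_Suc_atMost)
  ultimately show ?thesis
    using P that by blast
qed

end

text \<open>The sum is the coefficient of degree \<open>d\<close> in the Lagrange interpolant of
  \<open>p\<close> at \<open>d + 1\<close> nodes. The interpolant is \<open>p\<close> itself, whose
  degree is below \<open>d\<close>.\<close>

lemma sum_divided_difference_eq_0:
  fixes u :: "nat \<Rightarrow> 'a::field"
  assumes inj: "inj_on u {..d}" and deg: "Polynomial.degree p < d"
  shows "(\<Sum>i\<le>d. poly p (u i) / (\<Prod>k\<in>{..d} - {i}. u i - u k)) = 0"
proof -
  define D where "D i = (\<Prod>k\<in>{..d} - {i}. u i - u k)" for i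
  define l where "l i = (\<Prod>k\<in>{..d} - {i}. [:- u k, 1:])" for i
  define L where "L = (\<Sum>i\<le>d. Polynomial.smult (poly p (u i) / D i) (l i))"
  have D: "D i \<noteq> 0" if "i \<le> d" for i
    using inj that by (auto simp: D_def inj_on_def)
  have degl: "Polynomial.degree (l i) = d" if "i \<le> d" for i
    using that unfolding l_def by (subst degree_prod_eq_sum_degree) auto
  have coeffl: "poly.coeff (l i) d = 1" if "i \<le> d" for i
    using degl[OF that] lead_coeff_prod[of "\<lambda>k. [:- u k, 1:]" "{..d} - {i}"] by (simp add: l_def)
  have polyl: "poly (l i) (u j) = (if i = j then D j else 0)" if "i \<le> d" "j \<le> d" for i j
    using that by (auto simp: l_def D_def poly_prod intro!: prod_zero)
  have "poly L (u j) = poly p (u j)" if "j \<le> d" for j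
  proof -
    have "poly L (u j) = (\<Sum>i\<le>d. if i = j then poly p (u j) else 0)"
      unfolding L_def poly_sum using that D by (intro sum.cong) (auto simp: polyl)
    then show ?thesis
      using that by simp
  qed
  then have roots: "u ` {..d} \<subseteq> {v. poly (L - p) v = 0}"
    by auto
  have "L = p"
  proof (rule ccontr)
    assume "L \<noteq> p"
    then have "card (u ` {..d}) \<le> card {v. poly (L - p) v = 0}"
      by (intro card_mono poly_roots_finite roots) auto
    also have "\<dots> \<le> Polynomial.degree (L - p)"
      using \<open>L \<noteq> p\<close> by (intro card_poly_roots_bound) auto
    also have "\<dots> \<le> d"
      unfolding L_def using degl deg
      by (intro degree_diff_le degree_sum_le order.trans[OF degree_smult_le]) auto
    finally show False
      using inj by (simp add: card_image)
  qed
  then have "poly.coeff L d = 0"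
    using deg by (simp add: coeff_eq_0)
  then show ?thesis
    by (simp add: L_def coeff_sum coeffl D_def)
qed

section \<open>The q-power Frobenius\<close>

locale frobenius_ultrametric_field = ultrametric_field N for N :: "'c::{field,complete_space} \<Rightarrow> real" +
  fixes q :: nat
  assumes q_ge_2: "2 \<le> q"
    and frobenius_add: "(a + b :: 'c) ^ q = a ^ q + b ^ q"
begin

lemma q_pos [simp]: "0 < q"
  using q_ge_2 by simp

lemma q_pow_Suc_gt_1: "1 < q ^ Suc i"
  using q_ge_2 by (intro one_less_power) auto

lemma frobenius_diff: "(a - b :: 'c) ^ q = a ^ q - b ^ q"
  using frobenius_add[of "a - b" b] by (simp add: algebra_simps)

lemma frobenius_pow_diff: "(a - b :: 'c) ^ q ^ i = a ^ q ^ i - b ^ q ^ i"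
  by (induction i) (auto simp: power_mult frobenius_diff power_Suc2 simp del: power_Suc)

lemma frobenius_pow_add: "(a + b :: 'c) ^ q ^ i = a ^ q ^ i + b ^ q ^ i"
  by (induction i) (auto simp: power_mult frobenius_add power_Suc2 simp del: power_Suc)

lemma frobenius_sum: "(sum f I :: 'c) ^ q = (\<Sum>i\<in>I. f i ^ q)"
  by (induction I rule: infinite_finite_induct) (auto simp: frobenius_add power_0_left)

lemma N_pow_q_null: "N a < 1 \<Longrightarrow> (\<lambda>n. N a ^ q ^ n) \<longlonglongrightarrow> 0"
proof -
  assume "N a < 1"
  then have "(\<lambda>n. N a ^ n) \<longlonglongrightarrow> 0"
    by (intro LIMSEQ_realpow_zero) auto
  moreover have "strict_mono (\<lambda>n. q ^ n)"
    using q_ge_2 by (intro strict_monoI power_strict_increasing) auto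
  ultimately show ?thesis
    using LIMSEQ_subseq_LIMSEQ[of "\<lambda>n. N a ^ n" 0 "\<lambda>n. q ^ n"] by (simp add: o_def)
qed

end

section \<open>The brackets and the divided differences\<close>

text \<open>\<open>z\<close> and \<open>zq\<close> stand for the images of \<zeta> and its
  conjugate, and \<open>u = 1 / T\<close> is the uniformiser at the place
  \<open>t = zq\<close>.\<close>

locale quadratic_place = frobenius_ultrametric_field N q
  for N :: "'c::{field,complete_space} \<Rightarrow> real" and q :: nat +
  fixes z zq u t T Ts :: 'c
  assumes zq_eq: "z ^ q = zq" and z_eq: "zq ^ q = z" and z_neq: "z \<noteq> zq"
    and u_nonzero: "u \<noteq> 0" and N_u: "N u < 1"
    and t_eq: "t = zq + u" and T_eq: "T = 1 / (t - zq)" and Ts_eq: "Ts = 1 / (t - z)"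
begin

section \<open>The Frobenius powers of \<open>t\<close> and their distances\<close>

abbreviation tw :: "nat \<Rightarrow> 'c"
  where "tw i \<equiv> t ^ q ^ i"

abbreviation br :: "nat \<Rightarrow> 'c"
  where "br \<equiv> bracket q T Ts"

text \<open>Such a \<open>w\<close> is a root of unity, of order dividing
  \<open>q\<^sup>2 - 1\<close>.\<close>

lemma N_const:
  assumes "w ^ q\<^sup>2 = w" "w \<noteq> 0"
  shows "N w = 1"
proof -
  have "q\<^sup>2 = Suc (q\<^sup>2 - 1)" "q\<^sup>2 - 1 > 0"
    using q_pow_Suc_gt_1[of 1] by (auto simp: numeral_2_eq_2)
  then have "w ^ (q\<^sup>2 - 1) * w = w"
    using assms(1) by (metis power_Suc2)
  then have "N w ^ (q\<^sup>2 - 1) = 1"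
    using assms(2) by (simp flip: N_power)
  then show ?thesis
    using power_eq_iff_eq_base[of "q\<^sup>2 - 1" "N w" 1] \<open>q\<^sup>2 - 1 > 0\<close> by simp
qed

lemma N_z_diff: "N (z - zq) = 1" "N (zq - z) = 1"
proof -
  have "(z - zq) ^ q\<^sup>2 = z - zq"
    using frobenius_pow_diff[of z zq 2] by (simp add: power2_eq_square power_mult zq_eq z_eq)
  then show "N (z - zq) = 1"
    using z_neq by (intro N_const) auto
  then show "N (zq - z) = 1"
    by (simp add: N_diff_commute)
qed

lemma z_pow: "z ^ q ^ i = (if even i then z else zq)" "zq ^ q ^ i = (if even i then zq else z)"
  by (induction i) (auto simp: power_mult power_Suc2 zq_eq z_eq simp del: power_Suc)

text \<open>The parity of the index decides near which of the two conjugates \<open>tw i\<close>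
  lies. All distances below are read off from this.\<close>

lemma tw_eq: "tw i = (if even i then zq else z) + u ^ q ^ i"
  by (simp add: t_eq frobenius_pow_add z_pow)

lemma tw_Suc: "tw (Suc i) = tw i ^ q"
  by (simp add: power_mult[symmetric] mult.commute)

lemma N_u_pow: "N (u ^ q ^ i) < 1"
  using N_u by (simp add: N_power power_Suc_less_one power_strict_decreasing power_less_one_iff)

lemma N_u_pow_less: "i < j \<Longrightarrow> N (u ^ q ^ j) < N (u ^ q ^ i)"
  using N_u u_nonzero q_ge_2 unfolding N_power
  by (intro power_strict_decreasing power_strict_increasing) auto

text \<open>The two nodes lie near different conjugates, whose distance is 1.\<close>

lemma N_tw_diff_odd:
  assumes "odd (i + j)"
  shows "N (tw i - tw j) = 1"
proof -
  have *: "N (u ^ q ^ i - u ^ q ^ j) < 1"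
    using N_diff_le[of "u ^ q ^ i" "u ^ q ^ j"] N_u_pow[of i] N_u_pow[of j] by linarith
  show ?thesis
  proof (cases "even i")
    case True
    then have "tw i - tw j = (u ^ q ^ i - u ^ q ^ j) + (zq - z)"
      using assms by (simp add: tw_eq)
    then show ?thesis
      using N_add_eq[of "u ^ q ^ i - u ^ q ^ j" "zq - z"] * by (simp add: N_z_diff)
  next
    case False
    then have "tw i - tw j = (u ^ q ^ i - u ^ q ^ j) + (z - zq)"
      using assms by (simp add: tw_eq)
    then show ?thesis
      using N_add_eq[of "u ^ q ^ i - u ^ q ^ j" "z - zq"] * by (simp add: N_z_diff)
  qed
qed

text \<open>The constants cancel, and the lower power of \<open>u\<close> dominates.\<close>

lemma N_tw_diff_even:
  assumes "even (i + j)" "i < j"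
  shows "N (tw i - tw j) = N (u ^ q ^ i)"
  using N_diff_eq'[OF N_u_pow_less[OF assms(2)]] assms by (auto simp: tw_eq)

lemma N_tw_diff_zq: "N (tw i - zq) = (if even i then N (u ^ q ^ i) else 1)"
  using N_add_eq[of "u ^ q ^ i" "z - zq"] N_u_pow[of i]
  by (auto simp: tw_eq N_z_diff algebra_simps)

lemma tw_neq: "i \<noteq> j \<Longrightarrow> tw i \<noteq> tw j"
proof (induction i j rule: linorder_wlog)
  case (le i j)
  then have "N (tw i - tw j) > 0"
    using u_nonzero N_tw_diff_odd[of i j] N_tw_diff_even[of i j]
    by (cases "even (i + j)") (auto simp: N_power)
  then show ?case
    by auto
qed auto

lemma tw_neq_const: "tw i \<noteq> z" "tw i \<noteq> zq"
proof -
  \<comment> \<open>The left side is smaller than 1, the right sides have size 1.\<close>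
  have "u ^ q ^ i \<noteq> z - zq" "u ^ q ^ i \<noteq> zq - z"
    using N_u_pow[of i] N_z_diff by (metis less_irrefl)+
  then show "tw i \<noteq> z" "tw i \<noteq> zq"
    using u_nonzero by (auto simp: tw_eq algebra_simps)
qed

lemma t_neq_const: "t \<noteq> z" "t \<noteq> zq"
  using tw_neq_const[of 0] by auto

section \<open>Sizes of \<open>T\<close>, its conjugate and the brackets\<close>

lemma T_inverse: "T = 1 / u"
  by (simp add: T_eq t_eq)

lemma T_nonzero [simp]: "T \<noteq> 0" "Ts \<noteq> 0"
  using t_neq_const by (auto simp: T_eq Ts_eq)

lemma N_T: "1 < N T"
  using N_u u_nonzero by (simp add: T_inverse N_divide)

lemma N_Ts: "N Ts = 1"
proof -
  have "N (t - z) = N (u + (zq - z))"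
    by (simp add: t_eq algebra_simps)
  also have "\<dots> = 1"
    using N_add_eq[of u "zq - z"] N_u by (simp add: N_z_diff)
  finally show ?thesis
    by (simp add: Ts_eq N_divide)
qed

lemma T_pow: "T ^ q ^ k = 1 / (tw k - (if even k then zq else z))"
  by (simp add: T_inverse tw_eq power_divide)

text \<open>The two terms of the bracket are the reciprocals of \<open>tw k - s\<close> and
  \<open>t - s\<close> with the same constant \<open>s\<close>, namely \<open>zq\<close> for even
  \<open>k\<close> and \<open>z\<close> for odd \<open>k\<close>.\<close>

lemma bracket_eq: "br k = (t - tw k) * T ^ q ^ k * (if even k then T else Ts)"
proof -
  have "tw k - z \<noteq> 0" "tw k - zq \<noteq> 0" "t - z \<noteq> 0" "t - zq \<noteq> 0"
    using tw_neq_const[of k] t_neq_const by auto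
  then show ?thesis
    unfolding bracket_def T_pow by (auto simp: T_eq Ts_eq divide_simps)
qed

lemma N_bracket: "k \<ge> 1 \<Longrightarrow> N (br k) = N T ^ q ^ k"
proof -
  assume "k \<ge> 1"
  then have "N T ^ 1 < N T ^ q ^ k"
    using N_T q_pow_Suc_gt_1[of "k - 1"] by (intro power_strict_increasing) auto
  then have "N (if even k then T else Ts) < N (T ^ q ^ k)"
    using N_T by (auto simp: N_power N_Ts)
  then show ?thesis
    unfolding bracket_def by (subst N_diff_eq') (auto simp: N_power)
qed

lemma bracket_nonzero: "k \<ge> 1 \<Longrightarrow> br k \<noteq> 0"
  using N_bracket[of k] N_T by (metis N_0 power_eq_0_iff not_one_less_zero)

text \<open>The indices \<open>k\<close> and \<open>k + 2\<close> have the same parity, so the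
  subtracted \<open>T\<close> or \<open>Ts\<close> cancels.\<close>

lemma bracket_diff: "br (k + 2) - br k = br 2 ^ q ^ k"
  by (simp add: bracket_def frobenius_pow_diff power_mult[symmetric] mult_ac power2_eq_square)

section \<open>The summands of the divided difference\<close>

definition W :: "nat \<Rightarrow> nat \<Rightarrow> 'c"
  where "W n i = ((tw i - z) * (tw i - zq)) ^ n / (\<Prod>k\<in>{..2 * n + 1} - {i}. tw i - tw k)"

text \<open>The numerator polynomial has degree \<open>2 * n\<close>, so \<open>2 * n + 2\<close>
  nodes are the fewest for which the divided difference vanishes.\<close>

lemma sum_W_eq_0: "(\<Sum>i\<le>2 * n + 1. W n i) = 0"
proof -
  let ?p = "([:- z, 1:] * [:- zq, 1:]) ^ n"
  have "Polynomial.degree ?p \<le> Polynomial.degree ([:- z, 1:] * [:- zq, 1:]) * n"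
    by (rule degree_power_le)
  also have "\<dots> \<le> 2 * n"
    using degree_mult_le[of "[:- z, 1:]" "[:- zq, 1:]"] by simp
  finally have "Polynomial.degree ?p < 2 * n + 1"
    by simp
  moreover have "inj_on tw {..2 * n + 1}"
    using tw_neq by (auto simp: inj_on_def)
  ultimately show ?thesis
    using sum_divided_difference_eq_0[of tw "2 * n + 1" ?p] by (simp add: W_def algebra_simps)
qed

text \<open>The q-power map shifts every node by one and swaps \<open>z\<close> with
  \<open>zq\<close>, which preserves the numerator polynomial. The shifted nodes contain
  \<open>tw (2 * n + 2)\<close> in place of \<open>tw 0 = t\<close>; the last factor corrects for
  this exchange.\<close>

lemma W_Suc:
  assumes "i < 2 * n + 1"
  shows "W n (Suc i) = W n i ^ q * (tw (Suc i) - tw (2 * n + 2)) / (tw (Suc i) - t)"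
proof -
  let ?d = "2 * n + 1"
  let ?S = "{..<?d} - {i}"
  define D where "D = (\<Prod>k\<in>?S. tw (Suc i) - tw (Suc k))"
  have "{..?d} - {i} = insert ?d ?S"
    using assms by auto
  then have "(\<Prod>k\<in>{..?d} - {i}. tw i - tw k) ^ q = (\<Prod>k\<in>insert ?d ?S. tw (Suc i) - tw (Suc k))"
    by (simp only: prod_power_distrib frobenius_diff tw_Suc)
  then have 1: "(\<Prod>k\<in>{..?d} - {i}. tw i - tw k) ^ q = (tw (Suc i) - tw (2 * n + 2)) * D"
    by (simp add: D_def del: power_Suc)
  have "{..?d} - {Suc i} = insert 0 (Suc ` ?S)"
  proof (rule Set.set_eqI)
    show "k \<in> {..?d} - {Suc i} \<longleftrightarrow> k \<in> insert 0 (Suc ` ?S)" for k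
      by (cases k) auto
  qed
  then have 2: "(\<Prod>k\<in>{..?d} - {Suc i}. tw (Suc i) - tw k) = (tw (Suc i) - t) * D"
    by (simp add: D_def prod.reindex o_def del: power_Suc)
  have 3: "((tw i - z) * (tw i - zq)) ^ q = (tw (Suc i) - z) * (tw (Suc i) - zq)"
    by (simp only: power_mult_distrib frobenius_diff zq_eq z_eq tw_Suc mult.commute)
  have "W n i ^ q = ((tw (Suc i) - z) * (tw (Suc i) - zq)) ^ n / ((tw (Suc i) - tw (2 * n + 2)) * D)"
    unfolding W_def power_divide 1 3[symmetric] by (simp add: power_mult[symmetric] mult.commute)
  moreover have "tw (Suc i) - tw (2 * n + 2) \<noteq> 0"
    using tw_neq[of "Suc i" "2 * n + 2"] assms by simp
  ultimately show ?thesis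
    unfolding W_def 2 by (simp del: power_Suc)
qed

text \<open>From \<open>n\<close> to \<open>Suc n\<close> one more
  \<open>(t - z) * (t - zq) = 1 / (Ts * T)\<close> and the nodes \<open>2 * n + 2\<close> and
  \<open>2 * n + 3\<close> come in. By \<open>bracket_eq\<close> these nodes contribute one
  \<open>T\<close> and one \<open>Ts\<close>, which cancel.\<close>

lemma W_0: "W n 0 = T ^ q * Ts / br 1 * (\<Prod>i<2 * n. T ^ q ^ (i + 2) / br (i + 2))"
proof -
  have W: "W n 0 = ((t - z) * (t - zq)) ^ n / (\<Prod>k\<in>{1..2 * n + 1}. t - tw k)" for n
    unfolding W_def by (intro arg_cong2[of _ _ _ _ "(/)"] prod.cong) auto
  have nz: "t - tw k \<noteq> 0" if "k \<ge> 1" for k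
    using tw_neq[of 0 k] that by simp
  have pi: "(t - z) * (t - zq) = 1 / (Ts * T)"
    by (simp add: T_eq Ts_eq)
  have inv: "1 / (t - tw k) = T ^ q ^ k * (if even k then T else Ts) / br k" if "k \<ge> 1" for k
    unfolding bracket_eq using nz[OF that] by (simp add: divide_simps)
  show ?thesis
    unfolding W
  proof (induction n)
    case 0
    then show ?case
      using inv[of 1] by simp
  next
    case (Suc n)
    have "((t - z) * (t - zq)) ^ Suc n / (\<Prod>k\<in>{1..2 * Suc n + 1}. t - tw k) =
      ((t - z) * (t - zq)) ^ n / (\<Prod>k\<in>{1..2 * n + 1}. t - tw k) *
      ((t - z) * (t - zq) * (1 / (t - tw (2 * n + 2))) * (1 / (t - tw (2 * n + 3))))"
      by (simp add: eval_nat_numeral prod.nat_ivl_Suc' del: power_Suc) (simp add: field_simps)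
    also have "(t - z) * (t - zq) * (1 / (t - tw (2 * n + 2))) * (1 / (t - tw (2 * n + 3))) =
      T ^ q ^ (2 * n + 2) / br (2 * n + 2) * (T ^ q ^ (2 * n + 3) / br (2 * n + 3))"
      unfolding pi by (subst (1 2) inv) auto
    also have "((t - z) * (t - zq)) ^ n / (\<Prod>k\<in>{1..2 * n + 1}. t - tw k) * \<dots> =
      T ^ q * Ts / br 1 * (\<Prod>i<2 * Suc n. T ^ q ^ (i + 2) / br (i + 2))"
      unfolding Suc.IH by (simp add: eval_nat_numeral mult.assoc del: power_Suc)
    finally show ?case .
  qed
qed

lemma N_W_0: "N (W n 0) = 1"
proof -
  have "N (br k) = N (T ^ q ^ k)" if "k \<ge> 1" for k
    using N_bracket[OF that] by (simp add: N_power)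
  then have "N (T ^ q ^ k / br k) = 1" if "k \<ge> 1" for k
    using that by (simp add: N_divide)
  then have "N (T ^ q ^ (i + 2) / br (i + 2)) = 1" "N (T ^ q / br 1) = 1" for i
    by (metis le_add2 le_trans one_le_numeral, metis le_refl power_one_right)
  moreover have "W n 0 = Ts * (T ^ q / br 1) * (\<Prod>i<2 * n. T ^ q ^ (i + 2) / br (i + 2))"
    unfolding W_0 by simp
  ultimately show ?thesis
    by (simp only: N_mult N_prod N_Ts prod.neutral_const mult_1)
qed

section \<open>The infinite product and the limit of the summand at \<open>t\<close>\<close>

abbreviation carlitz_factor :: "nat \<Rightarrow> 'c"
  where "carlitz_factor i \<equiv> 1 - br (i + 1) / br (i + 3)"

lemma carlitz_factor_eq: "carlitz_factor i = br 2 ^ q ^ (i + 1) / br (i + 3)"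
  using bracket_diff[of "i + 1"] bracket_nonzero[of "i + 3"]
  by (simp add: field_simps eval_nat_numeral)

text \<open>The additional factor with \<open>i = 0\<close> on the right is
  \<open>br 2 / br 2 = 1\<close>.\<close>

lemma prod_carlitz_factor: "(\<Prod>i<m. carlitz_factor i) = (\<Prod>i<Suc m. br 2 ^ q ^ i / br (i + 2))"
  unfolding carlitz_factor_eq
  by (subst prod.lessThan_Suc_shift) (simp add: bracket_nonzero eval_nat_numeral)

lemma has_prod_carlitz_factor:
  obtains P where "N P = 1" "carlitz_factor has_prod P" "(\<lambda>n. \<Prod>i<n. carlitz_factor i) \<longlonglongrightarrow> P"
proof -
  have le: "N (br (i + 1) / br (i + 3)) \<le> N (u ^ q ^ (i + 1))" for i
  proof -
    \<comment> \<open>The size of the quotient is that of \<open>T\<close> raised to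
      \<open>q ^ (i + 1) - q ^ (i + 3)\<close>; this exponent is at most
      \<open>- (q ^ (i + 1))\<close>.\<close>
    have "2 * q ^ (i + 1) \<le> q ^ (i + 3)"
      using q_ge_2 mult_le_mono[of 2 q "q ^ (i + 1)" "q ^ (i + 2)"]
      by (simp add: eval_nat_numeral mult_le_mono)
    then have "N T ^ (q ^ (i + 1) + q ^ (i + 1)) \<le> N T ^ q ^ (i + 3)"
      using N_T by (intro power_increasing) auto
    then have "N (br (i + 1)) * N T ^ q ^ (i + 1) \<le> N (br (i + 3))"
      by (simp add: N_bracket power_add)
    moreover have "N (br (i + 3)) > 0"
      by (simp add: bracket_nonzero)
    ultimately have "N (br (i + 1)) / N (br (i + 3)) * N T ^ q ^ (i + 1) \<le> 1"
      by (simp add: divide_simps)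
    moreover have "N (u ^ q ^ (i + 1)) * N T ^ q ^ (i + 1) = 1"
      using u_nonzero by (simp add: T_inverse N_divide N_power power_one_over flip: power_mult_distrib)
    moreover have "N T ^ q ^ (i + 1) > 0"
      using N_T by simp
    ultimately show ?thesis
      unfolding N_divide by (metis mult_le_cancel_right_pos)
  qed
  show ?thesis
  proof (rule has_prod_one_minus[of "\<lambda>i. br (i + 1) / br (i + 3)"])
    show "N (br (i + 1) / br (i + 3)) < 1" for i
      using le[of i] N_u_pow[of "i + 1"] by linarith
    have "(\<lambda>i. N (u ^ q ^ (i + 1))) \<longlonglongrightarrow> 0"
      using LIMSEQ_Suc[OF N_pow_q_null[OF N_u]] by (simp add: N_power)
    then show "(\<lambda>i. N (br (i + 1) / br (i + 3))) \<longlonglongrightarrow> 0"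
      by (rule N_null_if_le[OF le])
  qed (rule that)
qed

lemma sum_pow_q: "(\<Sum>i<m. q ^ i) * (q - 1) + 1 = q ^ m"
proof (induction m)
  case (Suc m)
  obtain r where "q = Suc r"
    using q_pos by (cases q) auto
  then show ?case
    using Suc.IH by (simp add: algebra_simps)
qed auto

text \<open>In \<open>W_0\<close> the numerators are powers of \<open>T\<close>, in the Carlitz
  product powers of \<open>br 2\<close>. They differ by the powers \<open>g ^ q ^ i\<close>, whose
  product becomes \<open>g ^ (q ^ (2 * n) - 1)\<close> once raised to \<open>q - 1\<close>, and this
  tends to \<open>1 / g\<close>.\<close>

lemma tendsto_W_0:
  assumes "(\<lambda>n. \<Prod>i<n. carlitz_factor i) \<longlonglongrightarrow> P"
  shows "(\<lambda>n. W n 0 ^ (q - 1)) \<longlonglongrightarrow> (T ^ q * Ts / br 1 * P) ^ (q - 1) * (br 2 / T ^ q\<^sup>2)"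
proof -
  define g where "g = T ^ q\<^sup>2 / br 2"
  define Q where "Q m = (\<Prod>i<m. br 2 ^ q ^ i / br (i + 2))" for m
  have br2: "br 2 \<noteq> 0"
    by (simp add: bracket_nonzero)
  then have "g \<noteq> 0"
    by (simp add: g_def)
  have "(\<lambda>m. Q (Suc m)) \<longlonglongrightarrow> P"
    using assms unfolding Q_def prod_carlitz_factor .
  then have "Q \<longlonglongrightarrow> P"
    by (rule LIMSEQ_imp_Suc)
  then have Q: "(\<lambda>n. Q (2 * n)) \<longlonglongrightarrow> P"
    using LIMSEQ_subseq_LIMSEQ[of Q P "\<lambda>n. 2 * n"] by (auto simp: strict_mono_def o_def)
  \<comment> \<open>So \<open>g - 1\<close> is smaller than 1, and its Frobenius powers
    \<open>g ^ q ^ m - 1\<close> tend to 0.\<close>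
  have "g - 1 = T / br 2"
    using br2 by (simp add: g_def bracket_def field_simps)
  moreover have "N T ^ 1 < N T ^ q\<^sup>2"
    using N_T q_pow_Suc_gt_1[of 1] by (intro power_strict_increasing) (auto simp: numeral_2_eq_2)
  ultimately have "N (g - 1) < 1"
    using N_T by (simp add: N_divide N_bracket)
  then have "(\<lambda>m. N (g ^ q ^ m - 1)) \<longlonglongrightarrow> 0"
    using N_pow_q_null[of "g - 1"] by (simp add: frobenius_pow_diff N_power[symmetric])
  then have "(\<lambda>m. g ^ q ^ m) \<longlonglongrightarrow> 1"
    unfolding tendsto_iff_N .
  then have g: "(\<lambda>n. g ^ q ^ (2 * n)) \<longlonglongrightarrow> 1"
    using LIMSEQ_subseq_LIMSEQ[of "\<lambda>m. g ^ q ^ m" 1 "\<lambda>n. 2 * n"] by (auto simp: strict_mono_def o_def)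
  have W: "W n 0 ^ (q - 1) = (T ^ q * Ts / br 1 * Q (2 * n)) ^ (q - 1) * g ^ q ^ (2 * n) * (1 / g)" for n
  proof -
    have "T ^ q ^ (i + 2) = br 2 ^ q ^ i * g ^ q ^ i" for i
      using br2 by (simp add: g_def power_divide power_mult[symmetric] power2_eq_square mult_ac)
    then have "(\<Prod>i<2 * n. T ^ q ^ (i + 2) / br (i + 2)) = Q (2 * n) * (\<Prod>i<2 * n. g ^ q ^ i)"
      by (simp add: Q_def prod.distrib[symmetric] mult.commute)
    then have "W n 0 ^ (q - 1) = (T ^ q * Ts / br 1 * Q (2 * n)) ^ (q - 1) * g ^ ((\<Sum>i<2 * n. q ^ i) * (q - 1))"
      unfolding W_0 by (simp only: power_sum[symmetric] power_mult power_mult_distrib mult.assoc)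
    moreover have "g ^ q ^ (2 * n) = g ^ ((\<Sum>i<2 * n. q ^ i) * (q - 1) + 1)"
      by (simp only: sum_pow_q)
    ultimately show ?thesis
      using \<open>g \<noteq> 0\<close> by simp
  qed
  have "(\<lambda>n. W n 0 ^ (q - 1)) \<longlonglongrightarrow> (T ^ q * Ts / br 1 * P) ^ (q - 1) * 1 * (1 / g)"
    unfolding W by (rule tendsto_mult_N[OF tendsto_mult_N[OF tendsto_power_N[OF tendsto_mult_N[OF tendsto_const Q]] g] tendsto_const])
  then show ?thesis
    by (simp add: g_def)
qed


text \<open>At a small enough nonzero argument the first nonzero term strictly dominates all later
  ones, so the sum cannot vanish.\<close>

lemma sums_0_imp_coeffs_0:
  assumes sums: "\<And>w. (\<lambda>j. a j * w ^ q ^ j) sums (0 :: 'c)"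
  shows "a j = 0"
proof (rule ccontr)
  assume "a j \<noteq> 0"
  define J where "J = (LEAST j. a j \<noteq> 0)"
  have J: "a J \<noteq> 0"
    unfolding J_def by (rule LeastI[of _ j]) fact
  have below: "a i = 0" if "i < J" for i
    using that unfolding J_def by (auto dest: not_less_Least)
  have "(\<lambda>j. N (a j)) \<longlonglongrightarrow> 0"
    using summable_imp_null[OF sums_summable[OF sums[of 1]]] by simp
  then have "Bseq (\<lambda>j. N (a j))"
    by (intro convergent_imp_Bseq convergentI)
  then obtain B where B: "B > 0" "\<And>j. N (a j) \<le> B"
    by (auto simp: Bseq_def)
  have "(\<lambda>n. N u ^ n * B) \<longlonglongrightarrow> 0 * B"
    using N_u by (intro tendsto_mult LIMSEQ_realpow_zero tendsto_const) auto
  then have "eventually (\<lambda>n. N u ^ n * B < N (a J)) sequentially"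
    using J by (intro order_tendstoD(2)[where y = 0]) auto
  then obtain n where n: "N u ^ n * B < N (a J)"
    by (auto simp: eventually_sequentially)
  \<comment> \<open>The size of \<open>w\<close> times the bound \<open>B\<close> is below that of
    \<open>a J\<close>. The gap between \<open>q ^ J\<close> and the later exponents supplies the
    extra factor \<open>w\<close>.\<close>
  define w where "w = u ^ n"
  have w: "w \<noteq> 0" "N w \<le> 1" "N w * B < N (a J)"
    using u_nonzero N_u n by (auto simp: w_def N_power intro: power_le_one)
  have "N (a i * w ^ q ^ i) < N (a J * w ^ q ^ J)" if "i \<ge> Suc J" for i
  proof -
    have "q ^ J + 1 \<le> q ^ Suc J"
      using q_ge_2 by (simp add: Suc_le_eq)
    also have "\<dots> \<le> q ^ i"
      using that q_ge_2 by (intro power_increasing) auto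
    finally have "N w ^ q ^ i \<le> N w ^ (q ^ J + 1)"
      using w by (intro power_decreasing) auto
    then have "N (a i * w ^ q ^ i) \<le> B * N w ^ (q ^ J + 1)"
      using B by (simp add: N_mult N_power mult_mono)
    also have "\<dots> = (N w * B) * N w ^ q ^ J"
      by simp
    also have "\<dots> < N (a J) * N w ^ q ^ J"
      using w by (intro mult_strict_right_mono) auto
    finally show ?thesis
      by (simp add: N_mult N_power)
  qed
  then have "N (0 - (\<Sum>i<Suc J. a i * w ^ q ^ i)) < N (a J * w ^ q ^ J)"
    using sums J w by (intro sums_tail_less) auto
  moreover have "(\<Sum>i<Suc J. a i * w ^ q ^ i) = a J * w ^ q ^ J"
    using below by simp
  ultimately show False
    by simp
qed

end

section \<open>The exponential and its zero \<open>\<xi>\<close>\<close>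

locale carlitz_exponential = quadratic_place N q z zq u t T Ts
  for N :: "'c::{field,complete_space} \<Rightarrow> real" and q :: nat and z zq u t T Ts :: 'c +
  fixes x y :: 'c and c :: "nat \<Rightarrow> 'c"
  assumes x_eq: "x = 1 / ((t - z) * (t - zq))" and y_eq: "y = t / ((t - z) * (t - zq))"
    and c_0: "c 0 = 1"
    and summable: "summable (\<lambda>j. c j * w ^ q ^ j)"
    and T_plus_tau: "T * Fq_linear_series q c w + Fq_linear_series q c w ^ q =
      Fq_linear_series q c (y * w) - z * Fq_linear_series q c (x * w)"
begin

section \<open>Linearity and coefficients of the exponential\<close>

abbreviation E :: "'c \<Rightarrow> 'c"
  where "E \<equiv> Fq_linear_series q c"

lemma sums_E: "(\<lambda>j. c j * w ^ q ^ j) sums E w"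
  unfolding Fq_linear_series_def by (rule summable_sums[OF summable])

lemma E_diff: "E (v - w) = E v - E w"
proof (rule sums_unique2)
  show "(\<lambda>j. c j * (v - w) ^ q ^ j) sums E (v - w)"
    by (rule sums_E)
  show "(\<lambda>j. c j * (v - w) ^ q ^ j) sums (E v - E w)"
    unfolding frobenius_pow_diff right_diff_distrib by (intro sums_diff_N sums_E)
qed

lemma E_0 [simp]: "E 0 = 0"
  using E_diff[of 0 0] by simp

lemma Fq_pow: "a \<in> Fq q \<Longrightarrow> a ^ q ^ j = a"
  by (induction j) (auto simp: Fq_def power_mult)

lemma E_scale:
  assumes "a \<in> Fq q"
  shows "E (a * w) = a * E w"
proof (rule sums_unique2)
  show "(\<lambda>j. c j * (a * w) ^ q ^ j) sums E (a * w)"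
    by (rule sums_E)
  show "(\<lambda>j. c j * (a * w) ^ q ^ j) sums (a * E w)"
    using sums_mult_N[OF sums_E, of a w] by (simp add: power_mult_distrib Fq_pow assms mult_ac)
qed

text \<open>The q-th power moves each coefficient up by one place, which leaves 0 in place
  0.\<close>

lemma sums_E_pow:
  "(\<lambda>j. (case j of 0 \<Rightarrow> 0 | Suc i \<Rightarrow> c i ^ q) * w ^ q ^ j) sums (E w ^ q)"
proof -
  let ?f = "\<lambda>j. (case j of 0 \<Rightarrow> 0 | Suc i \<Rightarrow> c i ^ q) * w ^ q ^ j"
  have "(\<lambda>n. (\<Sum>j<n. c j * w ^ q ^ j) ^ q) \<longlonglongrightarrow> E w ^ q"
    using sums_E[of w] unfolding sums_def by (rule tendsto_power_N)
  moreover have "(\<Sum>j<n. c j * w ^ q ^ j) ^ q = (\<Sum>j<Suc n. ?f j)" for n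
    unfolding frobenius_sum
    by (subst sum.lessThan_Suc_shift) (simp add: power_mult_distrib power_mult[symmetric] mult.commute)
  ultimately have "(\<lambda>n. \<Sum>j<Suc n. ?f j) \<longlonglongrightarrow> E w ^ q"
    by simp
  then show ?thesis
    unfolding sums_def by (rule LIMSEQ_imp_Suc)
qed

text \<open>Coefficients of \<open>T_plus_tau\<close> are compared in place \<open>Suc j\<close>.
  There \<open>z\<close> itself is not raised to a power, so with \<open>s = tw (Suc j)\<close> the
  right side yields \<open>(s - z) / ((s - z) * (s - zq)) = 1 / (s - zq)\<close> for either
  parity.\<close>

lemma c_Suc: "c (Suc j) = c j ^ q * (tw (Suc j) - zq) / (T * (t - tw (Suc j)))"
proof -
  let ?d = "\<lambda>j. case j of 0 \<Rightarrow> 0 | Suc i \<Rightarrow> c i ^ q"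
  let ?a = "\<lambda>j. T * c j + ?d j - (c j * y ^ q ^ j - z * (c j * x ^ q ^ j))"
  have "(\<lambda>j. ?a j * w ^ q ^ j) sums 0" for w
  proof -
    have "(\<lambda>j. (T * (c j * w ^ q ^ j) + ?d j * w ^ q ^ j) -
        (c j * (y * w) ^ q ^ j - z * (c j * (x * w) ^ q ^ j))) sums
      ((T * E w + E w ^ q) - (E (y * w) - z * E (x * w)))"
      by (intro sums_add_N sums_diff_N sums_mult_N sums_E sums_E_pow)
    then show ?thesis
      by (simp add: T_plus_tau power_mult_distrib algebra_simps)
  qed
  then have "?a (Suc j) = 0"
    by (rule sums_0_imp_coeffs_0)
  moreover
  let ?s = "tw (Suc j)"
  have nz: "?s - z \<noteq> 0" "?s - zq \<noteq> 0" "t - zq \<noteq> 0" "t - ?s \<noteq> 0"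
    using tw_neq_const[of "Suc j"] t_neq_const tw_neq[of 0 "Suc j"] by auto
  have den: "((t - z) * (t - zq)) ^ q ^ Suc j = (?s - z) * (?s - zq)"
    unfolding power_mult_distrib frobenius_pow_diff z_pow by (simp add: mult.commute del: power_Suc)
  have "y ^ q ^ Suc j - z * x ^ q ^ Suc j = 1 / (?s - zq)"
    unfolding x_eq y_eq power_divide den using nz by (simp add: divide_simps del: power_Suc)
  ultimately have "c (Suc j) * (1 / (?s - zq) - T) = c j ^ q"
    by (simp add: algebra_simps del: power_Suc)
  moreover have "1 / (?s - zq) - T = T * (t - ?s) / (?s - zq)"
    unfolding T_eq using nz by (simp add: divide_simps del: power_Suc)
  ultimately show ?thesis
    using nz T_nonzero by (simp add: divide_simps del: power_Suc)
qed

end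

text \<open>Only \<open>\<xi> ^ (q - 1)\<close> is prescribed, so all choices of the root are
  treated alike. The limit is the constant factor in the recurrence \<open>r_Suc\<close>.\<close>

locale carlitz_period = carlitz_exponential N q z zq u t T Ts x y c
  for N :: "'c::{field,complete_space} \<Rightarrow> real" and q :: nat and z zq u t T Ts x y :: 'c and c +
  fixes \<xi> :: 'c
  assumes period_limit: "(\<lambda>n. W n 0 ^ (q - 1)) \<longlonglongrightarrow> - (\<xi> ^ (q - 1)) / T"
begin

section \<open>The terms of \<open>E \<xi> / \<xi>\<close> against the normalised summands\<close>

definition r :: "nat \<Rightarrow> 'c"
  where "r j = c j * \<xi> ^ (q ^ j - 1)"

definition R :: "nat \<Rightarrow> nat \<Rightarrow> 'c"
  where "R n j = W n j / W n 0"

lemma N_period_limit: "N (- (\<xi> ^ (q - 1)) / T) = 1"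
  using tendsto_N[OF period_limit] by (simp add: N_power N_W_0 LIMSEQ_const_iff)

lemma xi_nonzero [simp]: "\<xi> \<noteq> 0"
  using N_period_limit q_ge_2 by (auto simp: power_0_left split: if_splits)

lemma r_0 [simp]: "r 0 = 1"
  by (simp add: r_def c_0)

lemma c_xi_pow: "c j * \<xi> ^ q ^ j = \<xi> * r j"
proof -
  have "q ^ j = Suc (q ^ j - 1)"
    using q_pos by simp
  then have "\<xi> ^ q ^ j = \<xi> * \<xi> ^ (q ^ j - 1)"
    by (metis power_Suc)
  then show ?thesis
    by (simp add: r_def)
qed

lemma r_Suc:
  "r (Suc j) = r j ^ q * (- (\<xi> ^ (q - 1)) / T) * ((tw (Suc j) - zq) / (tw (Suc j) - t))"
proof -
  have "q ^ Suc j - 1 = (q ^ j - 1) * q + (q - 1)"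
    using q_pos by (cases "q ^ j"; cases q) (auto simp: algebra_simps)
  then have "\<xi> ^ (q ^ Suc j - 1) = (\<xi> ^ (q ^ j - 1)) ^ q * \<xi> ^ (q - 1)"
    by (simp only: power_add power_mult)
  moreover have "tw (Suc j) - t \<noteq> 0"
    using tw_neq[of "Suc j" 0] by simp
  ultimately show ?thesis
    unfolding r_def c_Suc by (simp add: power_mult_distrib field_simps del: power_Suc)
qed

lemma R_0 [simp]: "R n 0 = 1"
  using N_W_0[of n] by (auto simp: R_def)

text \<open>This is \<open>r_Suc\<close> with \<open>tw (2 * n + 2)\<close> for \<open>zq\<close>
  and \<open>W n 0 ^ (q - 1)\<close> for the constant; both converge to what they replace.\<close>

lemma R_Suc:
  assumes "j < 2 * n + 1"
  shows "R n (Suc j) = R n j ^ q * W n 0 ^ (q - 1) * ((tw (Suc j) - tw (2 * n + 2)) / (tw (Suc j) - t))"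
proof -
  have "W n 0 \<noteq> 0"
    using N_W_0[of n] by auto
  moreover have "W n 0 ^ q = W n 0 * W n 0 ^ (q - 1)"
    using q_pos by (metis power_Suc Suc_diff_1)
  ultimately show ?thesis
    unfolding R_def W_Suc[OF assms] by (simp add: power_divide)
qed

lemma N_r_Suc: "N (r (Suc j)) = N (r j) ^ q * (if even j then 1 else N u ^ q ^ Suc j / N u)"
proof -
  have "N (tw (Suc j) - t) = (if even j then 1 else N u)"
    using N_tw_diff_odd[of 0 "Suc j"] N_tw_diff_even[of 0 "Suc j"] N_diff_commute[of t "tw (Suc j)"]
    by simp
  then show ?thesis
    unfolding r_Suc N_mult N_divide N_tw_diff_zq N_period_limit[unfolded N_divide]
    by (simp add: N_power del: power_Suc)
qed

lemma N_r_Suc_le: "N (r (Suc j)) \<le> N (r j) ^ q"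
proof -
  have "N u ^ q ^ Suc j \<le> N u ^ 1"
    by (rule power_decreasing[OF less_imp_le[OF q_pow_Suc_gt_1] N_nonneg less_imp_le[OF N_u]])
  then have "(if even j then 1 else N u ^ q ^ Suc j / N u) \<le> 1"
    using u_nonzero by simp
  then show ?thesis
    unfolding N_r_Suc by (intro mult_left_le) auto
qed

lemma N_r_le_1: "N (r j) \<le> 1"
proof (induction j)
  case (Suc j)
  then show ?case
    using N_r_Suc_le[of j] power_le_one[of "N (r j)" q] by simp
qed simp

lemma N_r_1: "N (r 1) = 1"
  using N_r_Suc[of 0] by simp

text \<open>The step from 1 to 2 brings in a factor of size \<open>N u ^ (q\<^sup>2 - 1)\<close>,
  and later steps keep the size below 1. Only the terms 0 and 1 of \<open>E \<xi>\<close> thus have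
  maximal size.\<close>

lemma N_r_less_1: "2 \<le> j \<Longrightarrow> N (r j) < 1"
proof (induction j rule: nat_induct_at_least)
  case base
  have "N u ^ q\<^sup>2 < N u ^ 1"
    using N_u u_nonzero q_pow_Suc_gt_1[of 1] by (intro power_strict_decreasing) (auto simp: numeral_2_eq_2)
  then show ?case
    using N_r_Suc[of 1] N_r_1 u_nonzero by (simp add: numeral_2_eq_2)
next
  case (Suc j)
  have "N (r j) ^ q < 1"
    using Suc.IH by (simp add: power_less_one_iff)
  then show ?case
    using N_r_Suc_le[of j] by simp
qed

lemma tendsto_R: "(\<lambda>n. R n j) \<longlonglongrightarrow> r j"
proof (induction j)
  case (Suc j)
  \<comment> \<open>The even index makes \<open>tw (2 * n + 2)\<close> tend to \<open>zq\<close> and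
    not to \<open>z\<close>.\<close>
  have "(\<lambda>n. N (u ^ q ^ (2 * n + 2))) \<longlonglongrightarrow> 0"
    using LIMSEQ_subseq_LIMSEQ[OF N_pow_q_null[OF N_u], of "\<lambda>n. 2 * n + 2"]
    by (simp add: strict_mono_def o_def N_power)
  moreover have "N (u ^ q ^ (2 * n + 2)) = N ((tw (Suc j) - tw (2 * n + 2)) - (tw (Suc j) - zq))" for n
    by (simp add: N_diff_commute[of zq] N_tw_diff_zq del: power_Suc)
  ultimately have "(\<lambda>n. tw (Suc j) - tw (2 * n + 2)) \<longlonglongrightarrow> tw (Suc j) - zq"
    by (simp add: tendsto_iff_N)
  then have "(\<lambda>n. (tw (Suc j) - tw (2 * n + 2)) * (1 / (tw (Suc j) - t))) \<longlonglongrightarrow>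
      (tw (Suc j) - zq) * (1 / (tw (Suc j) - t))"
    by (rule tendsto_mult_N[OF _ tendsto_const])
  then have "(\<lambda>n. R n j ^ q * W n 0 ^ (q - 1) * ((tw (Suc j) - tw (2 * n + 2)) / (tw (Suc j) - t)))
      \<longlonglongrightarrow> r (Suc j)"
    unfolding r_Suc by (intro tendsto_mult_N[OF tendsto_mult_N[OF tendsto_power_N[OF Suc.IH] period_limit]]) simp
  moreover have "eventually (\<lambda>n. R n j ^ q * W n 0 ^ (q - 1) *
      ((tw (Suc j) - tw (2 * n + 2)) / (tw (Suc j) - t)) = R n (Suc j)) sequentially"
    using eventually_ge_at_top[of j] by eventually_elim (simp add: R_Suc del: power_Suc)
  ultimately show ?case
    by (rule Lim_transform_eventually)
qed simp

text \<open>The node \<open>tw (2 * n + 2)\<close> lies closer to \<open>zq\<close> than every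
  earlier node, so exchanging the two changes no size. One bound on \<open>r j\<close> therefore
  serves for all \<open>n\<close> at once.\<close>

lemma N_R: "j \<le> 2 * n + 1 \<Longrightarrow> N (R n j) = N (r j)"
proof (induction j)
  case (Suc j)
  then have "N (tw (Suc j) - tw (2 * n + 2)) = N (tw (Suc j) - zq)"
    using N_tw_diff_odd[of "Suc j" "2 * n + 2"] N_tw_diff_even[of "Suc j" "2 * n + 2"]
    by (cases "even j") (simp_all add: N_tw_diff_zq del: power_Suc)
  moreover have "N (R n j) = N (r j)" "j < 2 * n + 1"
    using Suc by auto
  ultimately show ?case
    unfolding R_Suc[OF \<open>j < 2 * n + 1\<close>] r_Suc N_mult N_period_limit N_divide N_power
    using N_period_limit by (simp add: N_W_0 N_divide N_power del: power_Suc)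
qed simp

text \<open>Dominated convergence: from \<open>m\<close> on all \<open>R n j\<close> are at most
  \<open>e\<close>, and their full sum is 0, so the sum of the first \<open>m\<close> is at most
  \<open>e\<close>. This passes to the first \<open>m\<close> terms \<open>r j\<close>, whose tail
  is at most \<open>e\<close> as well.\<close>

lemma E_xi: "E \<xi> = 0"
proof -
  have r: "r sums (E \<xi> / \<xi>)"
    using sums_mult_N[OF sums_E[of \<xi>], of "1 / \<xi>"] by (simp add: c_xi_pow)
  have "N (E \<xi> / \<xi>) \<le> e" if "e > 0" for e
  proof -
    obtain m where m: "\<And>j. j \<ge> m \<Longrightarrow> N (r j) \<le> e"
      using summable_imp_null[OF sums_summable[OF r]] \<open>e > 0\<close>
      by (fastforce simp: lim_sequentially intro: less_imp_le)
    have "N (\<Sum>j<m. R n j) \<le> e" if "n \<ge> m" for n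
    proof -
      have "(\<Sum>j\<le>2 * n + 1. R n j) = 0"
        unfolding R_def sum_divide_distrib[symmetric] sum_W_eq_0 by simp
      then have "(\<Sum>j<m. R n j) + (\<Sum>j\<in>{m..<2 * n + 2}. R n j) = 0"
        using \<open>n \<ge> m\<close> sum.atLeastLessThan_concat[of 0 m "2 * n + 2" "R n"]
        by (simp add: lessThan_atLeast0 atMost_atLeast0 atLeastLessThanSuc_atLeastAtMost)
      then have "N (\<Sum>j<m. R n j) = N (\<Sum>j\<in>{m..<2 * n + 2}. R n j)"
        by (metis N_minus add_eq_0_iff)
      also have "\<dots> \<le> e"
        using \<open>e > 0\<close> m by (intro N_sum_le) (auto simp: N_R)
      finally show ?thesis .
    qed
    moreover have "(\<lambda>n. N (\<Sum>j<m. R n j)) \<longlonglongrightarrow> N (\<Sum>j<m. r j)"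
      by (intro tendsto_N tendsto_sum_N tendsto_R)
    ultimately have "N (\<Sum>j<m. r j) \<le> e"
      by (auto intro: LIMSEQ_le_const2)
    moreover have "N (E \<xi> / \<xi> - (\<Sum>j<m. r j)) \<le> e"
      using \<open>e > 0\<close> m by (intro sums_tail_le[OF r]) auto
    ultimately show ?thesis
      using N_add_le[of "E \<xi> / \<xi> - (\<Sum>j<m. r j)" "\<Sum>j<m. r j"] by auto
  qed
  then have "N (E \<xi> / \<xi>) \<le> 0"
    by (meson field_le_epsilon add_0_left order.trans dense_ge)
  then show ?thesis
    using N_nonneg[of "E \<xi> / \<xi>"] by simp
qed

end

section \<open>Descent in the period lattice\<close>

locale carlitz_lattice = carlitz_period N q z zq u t T Ts x y c \<xi>
  for N :: "'c::{field,complete_space} \<Rightarrow> real" and q :: nat and z zq u t T Ts x y :: 'c and c and \<xi> :: 'c +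
  fixes A :: "'c set" and b :: 'c
  assumes A_eq: "A = Fq_algebra q {x, y}"
    and card_Fq: "card (Fq q :: 'c set) = q"
    and E_x_mult: "E (x * w) = x * E w + b * E w ^ q + Ts / T * E w ^ q\<^sup>2"
    and E_A_mult: "a \<in> A \<Longrightarrow> E w = 0 \<Longrightarrow> E (a * w) = 0"
begin

section \<open>The subfield with \<open>q\<close> elements\<close>

lemma finite_Fq: "finite (Fq q :: 'c set)"
  using card_Fq q_pos by (metis card.infinite less_irrefl)

lemma Fq_diff: "a \<in> Fq q \<Longrightarrow> a' \<in> Fq q \<Longrightarrow> a - a' \<in> (Fq q :: 'c set)"
  by (simp add: Fq_def frobenius_diff)

text \<open>Both sides are monic of degree \<open>q\<close> in \<open>s\<close> and vanish on
  \<open>Fq q\<close>; their difference would have more roots than its degree allows.\<close>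

lemma prod_Fq: "(\<Prod>a\<in>Fq q. s - a) = s ^ q - (s :: 'c)"
proof -
  define p where "p = (\<Prod>a\<in>Fq q. [:- a, 1 :: 'c:]) - (Polynomial.monom 1 q - [:0, 1:])"
  have deg: "Polynomial.degree (\<Prod>a\<in>Fq q. [:- a, 1 :: 'c:]) = q"
    by (subst degree_prod_eq_sum_degree) (auto simp: card_Fq)
  have "poly.coeff (\<Prod>a\<in>Fq q. [:- a, 1 :: 'c:]) q = 1"
    using lead_coeff_prod[of "\<lambda>a. [:- a, 1 :: 'c:]" "Fq q"] by (simp add: deg)
  then have "poly.coeff p q = 0"
    using q_ge_2 by (simp add: p_def coeff_pCons split: nat.split)
  moreover have "Polynomial.degree p \<le> q"
    unfolding p_def using q_ge_2 by (intro degree_diff_le) (auto simp: deg degree_monom_le)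
  ultimately have p: "p = 0 \<or> Polynomial.degree p < q"
    by (rule eq_zero_or_degree_less[rotated])
  have roots: "(Fq q :: 'c set) \<subseteq> {s. poly p s = 0}"
  proof
    fix a :: 'c
    assume a: "a \<in> Fq q"
    then have "(\<Prod>a'\<in>Fq q. a - a') = 0"
      using finite_Fq by (intro prod_zero) auto
    then show "a \<in> {s. poly p s = 0}"
      using a by (simp add: p_def poly_prod poly_monom Fq_def)
  qed
  have "p = 0"
  proof (rule ccontr)
    assume "p \<noteq> 0"
    then have "q \<le> Polynomial.degree p"
      using card_mono[OF poly_roots_finite roots] card_poly_roots_bound[of p] card_Fq by simp
    then show False
      using p \<open>p \<noteq> 0\<close> by simp
  qed
  then have "poly p s = 0"
    by simp
  then show ?thesis
    by (simp add: p_def poly_prod poly_monom)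
qed

section \<open>Periods of size at most that of \<xi>\<close>

lemma N_c_pow: "N (c j * w ^ q ^ j) = N w * (N (r j) * (N w / N \<xi>) ^ (q ^ j - 1))"
proof -
  have "q ^ j = Suc (q ^ j - 1)"
    using q_pos by simp
  then have "N w ^ q ^ j = N w * N w ^ (q ^ j - 1)"
    by (metis power_Suc)
  then show ?thesis
    by (simp add: N_mult N_power r_def power_divide)
qed

text \<open>Below the size of \<xi> the linear term strictly dominates the series
  \<open>E w\<close>.\<close>

lemma period_eq_0:
  assumes "E w = 0" "N w < N \<xi>"
  shows "w = 0"
proof (rule ccontr)
  assume w: "w \<noteq> 0"
  have "N (c j * w ^ q ^ j) < N w" if "j \<ge> 1" for j
  proof -
    have "q ^ j - 1 > 0"
      using that q_pow_Suc_gt_1[of "j - 1"] by simp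
    then have "(N w / N \<xi>) ^ (q ^ j - 1) < 1"
      using assms by (simp add: power_less_one_iff)
    moreover have "N (r j) * (N w / N \<xi>) ^ (q ^ j - 1) \<le> (N w / N \<xi>) ^ (q ^ j - 1)"
      using N_r_le_1[of j] by (intro mult_left_le_one_le) auto
    ultimately have "N (r j) * (N w / N \<xi>) ^ (q ^ j - 1) < 1"
      by linarith
    then show ?thesis
      unfolding N_c_pow using mult_strict_left_mono[of _ 1 "N w"] w by simp
  qed
  then have "N (E w - (\<Sum>j<1. c j * w ^ q ^ j)) < N w"
    using w by (intro sums_tail_less[OF sums_E]) auto
  then show False
    using assms by (simp add: c_0)
qed

text \<open>Terms from index 2 on are too small to matter, so \<open>v + c 1 * v ^ q\<close> is
  small for \<open>v = w\<close> and for \<open>v = \<xi>\<close>. Eliminating \<open>r 1\<close>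
  makes \<open>s ^ q - s\<close> small for \<open>s = w / \<xi>\<close>. Hence \<open>s\<close> is
  near some \<open>a\<close> in \<open>Fq q\<close>, and the period \<open>w - a * \<xi>\<close> is
  too small to be nonzero.\<close>

lemma minimal_period:
  assumes w: "E w = 0" "N w = N \<xi>"
  obtains a where "a \<in> Fq q" "w = \<xi> * a"
proof -
  have near: "N (v + c 1 * v ^ q) < N \<xi>" if "E v = 0" "N v = N \<xi>" for v
  proof -
    have "N (c j * v ^ q ^ j) < N \<xi>" if "j \<ge> 2" for j
      unfolding N_c_pow using N_r_less_1[OF that] \<open>N v = N \<xi>\<close> by simp
    then have "N (E v - (\<Sum>j<2. c j * v ^ q ^ j)) < N \<xi>"
      by (intro sums_tail_less[OF sums_E]) auto
    then have "N (- (v + c 1 * v ^ q)) < N \<xi>"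
      using that by (simp add: c_0 numeral_2_eq_2)
    then show ?thesis
      by (simp only: N_minus)
  qed
  define s where "s = w / \<xi>"
  have w_eq: "w = \<xi> * s"
    by (simp add: s_def)
  have "N s = 1"
    using w by (simp add: s_def N_divide)
  have c1: "c 1 * \<xi> ^ q = \<xi> * r 1"
    using c_xi_pow[of 1] by simp
  then have "w + c 1 * w ^ q = \<xi> * (s + r 1 * s ^ q)"
    by (simp add: w_eq power_mult_distrib algebra_simps)
  moreover have "\<xi> + c 1 * \<xi> ^ q = \<xi> * (1 + r 1)"
    using c1 by (simp add: algebra_simps)
  ultimately have "N (s + r 1 * s ^ q) < 1" "N (1 + r 1) < 1"
    using near[of w] near[of \<xi>] w E_xi by (simp_all add: N_mult)
  then have "N ((1 + r 1) * s ^ q - (s + r 1 * s ^ q)) < 1"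
    using N_diff_le[of "(1 + r 1) * s ^ q" "s + r 1 * s ^ q"]
    by (simp add: N_mult N_power \<open>N s = 1\<close>)
  then have "(\<Prod>a\<in>Fq q. N (s - a)) < 1"
    by (simp add: N_prod[symmetric] prod_Fq algebra_simps)
  then obtain a where a: "a \<in> Fq q" "N (s - a) < 1"
    using prod_ge_1[of "Fq q" "\<lambda>a. N (s - a)"] by force
  have "w - a * \<xi> = \<xi> * (s - a)"
    by (simp add: w_eq algebra_simps)
  then have "N (w - a * \<xi>) < N \<xi>"
    using a by (simp add: N_mult)
  moreover have "E (w - a * \<xi>) = 0"
    using w a by (simp add: E_diff E_scale E_xi)
  ultimately have "w - a * \<xi> = 0"
    by (rule period_eq_0[rotated])
  then show ?thesis
    using a that[of a] by (simp add: mult.commute)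
qed

lemma period_N_le:
  assumes "E w = 0" "N w \<le> N \<xi>"
  obtains a where "a \<in> Fq q" "w = \<xi> * a"
proof (cases "N w = N \<xi>")
  case False
  then have "w = 0"
    using assms period_eq_0[of w] by simp
  then show ?thesis
    using that[of 0] by (simp add: Fq_def power_0_left)
qed (use assms minimal_period that in blast)

section \<open>Torsion points and reduction of periods\<close>

lemma x_eq_T: "x = T * Ts"
  by (simp add: x_eq T_eq Ts_eq)

lemma y_eq_x: "y = t * x"
  by (simp add: x_eq y_eq)

lemma x_nonzero [simp]: "x \<noteq> 0"
  by (simp add: x_eq_T)

lemma N_x: "N x > 1"
  using N_T by (simp add: x_eq_T N_mult N_Ts)

lemma N_Fq: "a \<in> Fq q \<Longrightarrow> N a \<le> 1"
  using N_const[of a] Fq_pow[of a 2] by (cases "a = 0") auto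

text \<open>Up to a multiple of \<open>u\<close> this is \<open>\<alpha> + \<beta> * zq\<close>, a
  nonzero constant because 1 and \<open>zq\<close> are independent over \<open>Fq q\<close>.\<close>

lemma N_linear:
  assumes "\<alpha> \<in> Fq q" "\<beta> \<in> Fq q" "\<alpha> \<noteq> 0 \<or> \<beta> \<noteq> 0"
  shows "N (\<alpha> + \<beta> * t) = 1"
proof -
  have "zq ^ q \<noteq> zq"
    using z_eq z_neq by simp
  have pow: "\<alpha> ^ q = \<alpha>" "\<beta> ^ q = \<beta>"
    using assms by (auto simp: Fq_def)
  have "\<alpha> + \<beta> * zq \<noteq> 0"
  proof
    assume *: "\<alpha> + \<beta> * zq = 0"
    \<comment> \<open>The q-power map fixes \<alpha> and \<beta> and sends \<open>zq\<close> to
      \<open>z\<close>; the difference of the two relations forces \<beta> to be 0.\<close>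
    then have "(\<alpha> + \<beta> * zq) ^ q = 0"
      by (simp add: power_0_left)
    then have "\<alpha> + \<beta> * z = 0"
      by (simp add: frobenius_add power_mult_distrib pow z_eq)
    with * have "\<beta> * (z - zq) = 0"
      by (simp add: algebra_simps add_eq_0_iff)
    then show False
      using * assms(3) z_neq by simp
  qed
  moreover have "(\<alpha> + \<beta> * zq) ^ q\<^sup>2 = \<alpha> + \<beta> * zq"
    by (simp add: frobenius_pow_add power_mult_distrib z_pow Fq_pow assms)
  ultimately have "N (\<alpha> + \<beta> * zq) = 1"
    by (intro N_const)
  moreover have "N (\<beta> * u) \<le> N u"
    using N_Fq[OF assms(2)] unfolding N_mult by (intro mult_left_le_one_le) auto
  then have "N (\<beta> * u) < 1"
    using N_u by simp
  ultimately show ?thesis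
    using N_add_eq[of "\<beta> * u" "\<alpha> + \<beta> * zq"] by (simp add: t_eq algebra_simps)
qed

lemma E_combination:
  assumes "\<alpha> \<in> Fq q" "\<beta> \<in> Fq q"
  shows "E (\<xi> * (\<alpha> + \<beta> * y)) = 0"
proof -
  have "\<alpha> + \<beta> * y \<in> A"
    unfolding A_eq using assms
    by (auto intro!: Fq_algebra.add Fq_algebra.mult intro: Fq_algebra.const Fq_algebra.gen)
  from E_A_mult[OF this E_xi] show ?thesis
    by (simp add: mult.commute)
qed

text \<open>The argument of \<open>E\<close> is a period no larger than \<xi>, hence
  \<open>\<xi> * \<gamma>\<close> with \<gamma> in \<open>Fq q\<close>. This gives
  \<open>\<alpha> = x * (\<gamma> - \<beta> * t)\<close>, which by \<open>N_linear\<close> has size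
  \<open>N x > 1\<close> unless \<gamma> and \<beta> vanish.\<close>

lemma combination_torsion_eq_0:
  assumes ab: "\<alpha> \<in> Fq q" "\<beta> \<in> Fq q" and E: "E (\<xi> * (\<alpha> + \<beta> * y) / x) = 0"
  shows "\<alpha> = 0 \<and> \<beta> = 0"
proof -
  have N_beta_t: "N (\<beta> * t) \<le> 1"
    using N_linear[of 0 \<beta>] ab by (cases "\<beta> = 0") (auto simp: Fq_def power_0_left)
  have "N (\<beta> * y) \<le> N x"
  proof -
    have "N (\<beta> * y) = N (\<beta> * t) * N x"
      by (simp add: y_eq_x N_mult)
    then show ?thesis
      using N_beta_t mult_left_le_one_le[of "N x" "N (\<beta> * t)"] by simp
  qed
  then have "N (\<alpha> + \<beta> * y) \<le> N x"
    using N_add_le[of \<alpha> "\<beta> * y"] N_Fq[OF ab(1)] N_x by linarith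
  then have "N (\<xi> * (\<alpha> + \<beta> * y) / x) \<le> N \<xi>"
    using N_x by (simp add: N_mult N_divide divide_simps)
  with E obtain \<gamma> where \<gamma>: "\<gamma> \<in> Fq q" "\<xi> * (\<alpha> + \<beta> * y) / x = \<xi> * \<gamma>"
    by (rule period_N_le)
  then have "\<xi> * (\<alpha> + \<beta> * y) = \<xi> * (\<gamma> * x)"
    by (simp add: divide_simps mult.assoc)
  then have "\<alpha> + \<beta> * y = \<gamma> * x"
    by simp
  then have "\<alpha> = x * (\<gamma> - \<beta> * t)"
    by (simp add: y_eq_x algebra_simps)
  have "\<gamma> = 0 \<and> \<beta> = 0"
  proof (rule ccontr)
    assume "\<not> (\<gamma> = 0 \<and> \<beta> = 0)"
    moreover have "- \<beta> \<in> Fq q"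
      using Fq_diff[of 0 \<beta>] ab by (simp add: Fq_def power_0_left)
    ultimately have "N (\<gamma> - \<beta> * t) = 1"
      using N_linear[of \<gamma> "- \<beta>"] \<gamma> by auto
    then have "N \<alpha> = N x"
      using \<open>\<alpha> = x * (\<gamma> - \<beta> * t)\<close> by (simp add: N_mult)
    then show False
      using N_x N_Fq[OF ab(1)] by simp
  qed
  then show ?thesis
    using \<open>\<alpha> = x * (\<gamma> - \<beta> * t)\<close> by simp
qed

lemma torsion_roots:
  shows "finite {v. x * v + b * v ^ q + Ts / T * v ^ q\<^sup>2 = 0}"
    and "card {v. x * v + b * v ^ q + Ts / T * v ^ q\<^sup>2 = 0} \<le> q\<^sup>2"
proof -
  define p where "p = Polynomial.monom x 1 + Polynomial.monom b q + Polynomial.monom (Ts / T) (q\<^sup>2)"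
  have "1 < q" "q < q\<^sup>2"
    using q_ge_2 by (auto simp: power2_eq_square)
  then have "poly.coeff p (q\<^sup>2) = Ts / T"
    by (simp add: p_def)
  then have "p \<noteq> 0"
    by auto
  have "Polynomial.degree p \<le> q\<^sup>2"
    unfolding p_def using \<open>1 < q\<close> \<open>q < q\<^sup>2\<close>
    by (intro degree_add_le order.trans[OF degree_monom_le]) auto
  moreover have "{v. x * v + b * v ^ q + Ts / T * v ^ q\<^sup>2 = 0} = {v. poly p v = 0}"
    by (simp add: p_def poly_monom)
  ultimately show "finite {v. x * v + b * v ^ q + Ts / T * v ^ q\<^sup>2 = 0}"
    "card {v. x * v + b * v ^ q + Ts / T * v ^ q\<^sup>2 = 0} \<le> q\<^sup>2"
    using poly_roots_finite[OF \<open>p \<noteq> 0\<close>] card_poly_roots_bound[OF \<open>p \<noteq> 0\<close>] by auto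
qed

text \<open>
  The \<open>q\<^sup>2\<close> combinations \<open>\<alpha> + \<beta> y\<close> already give all \<open>x\<close>-torsion points, because these are the
  roots of a polynomial of degree \<open>q\<^sup>2\<close>.
\<close>
lemma period_reduce:
  assumes w: "E w = 0"
  obtains \<alpha> \<beta> w' where "\<alpha> \<in> Fq q" "\<beta> \<in> Fq q" "E w' = 0" "w = \<xi> * (\<alpha> + \<beta> * y) + x * w'"
proof -
  define f where "f = (\<lambda>(\<alpha>, \<beta>). E (\<xi> * (\<alpha> + \<beta> * y) / x))"
  let ?F = "Fq q \<times> Fq q :: ('c \<times> 'c) set"
  let ?V = "{v. x * v + b * v ^ q + Ts / T * v ^ q\<^sup>2 = 0}"
  have V: "E (v / x) \<in> ?V" if "E v = 0" for v
    using E_x_mult[of "v / x"] that by simp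
  have "inj_on f ?F"
  proof (rule inj_onI, clarify)
    fix \<alpha> \<beta> \<alpha>' \<beta>' :: 'c
    assume *: "\<alpha> \<in> Fq q" "\<beta> \<in> Fq q" "\<alpha>' \<in> Fq q" "\<beta>' \<in> Fq q" "f (\<alpha>, \<beta>) = f (\<alpha>', \<beta>')"
    have "\<xi> * ((\<alpha> - \<alpha>') + (\<beta> - \<beta>') * y) / x =
        \<xi> * (\<alpha> + \<beta> * y) / x - \<xi> * (\<alpha>' + \<beta>' * y) / x"
      by (simp add: diff_divide_distrib[symmetric] algebra_simps)
    then have "E (\<xi> * ((\<alpha> - \<alpha>') + (\<beta> - \<beta>') * y) / x) = 0"
      using * by (simp add: f_def E_diff)
    then have "\<alpha> - \<alpha>' = 0 \<and> \<beta> - \<beta>' = 0"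
      using * by (intro combination_torsion_eq_0 Fq_diff)
    then show "\<alpha> = \<alpha>' \<and> \<beta> = \<beta>'"
      by simp
  qed
  then have "card (f ` ?F) = q\<^sup>2"
    by (simp add: card_image card_cartesian_product card_Fq power2_eq_square)
  moreover have "f ` ?F \<subseteq> ?V"
    using V E_combination by (auto simp: f_def)
  ultimately have "f ` ?F = ?V"
    using torsion_roots by (intro card_seteq) auto
  then have "E (w / x) \<in> f ` ?F"
    using V[OF w] by simp
  then obtain \<alpha> \<beta> where ab: "\<alpha> \<in> Fq q" "\<beta> \<in> Fq q" "E (w / x) = E (\<xi> * (\<alpha> + \<beta> * y) / x)"
    by (auto simp: f_def)
  show ?thesis
  proof
    show "\<alpha> \<in> Fq q" "\<beta> \<in> Fq q"
      by fact+
    show "E (w / x - \<xi> * (\<alpha> + \<beta> * y) / x) = 0"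
      by (simp add: E_diff ab)
    show "w = \<xi> * (\<alpha> + \<beta> * y) + x * (w / x - \<xi> * (\<alpha> + \<beta> * y) / x)"
      by (simp add: right_diff_distrib)
  qed
qed

text \<open>The combination split off by \<open>period_reduce\<close> has size at most
  \<open>N \<xi> * N x\<close>, so \<open>x * w'\<close> obeys the bound for \<open>w\<close>, and
  each reduction gains a factor \<open>N x\<close>.\<close>

lemma period_in_lattice:
  assumes "E w = 0" "N w \<le> N \<xi> * N x ^ n"
  shows "\<exists>a\<in>A. w = \<xi> * a"
  using assms
proof (induction n arbitrary: w)
  case 0
  then obtain a where "a \<in> Fq q" "w = \<xi> * a"
    by (auto elim: period_N_le)
  then show ?case
    by (auto simp: A_eq intro: Fq_algebra.const)
next
  case (Suc n)
  obtain \<alpha> \<beta> w' where ab: "\<alpha> \<in> Fq q" "\<beta> \<in> Fq q" and w': "E w' = 0"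
    and w: "w = \<xi> * (\<alpha> + \<beta> * y) + x * w'"
    using Suc.prems(1) by (rule period_reduce)
  have "N t = 1"
    using N_linear[of 0 1] by (simp add: Fq_def power_0_left)
  then have "N (\<beta> * y) \<le> N x"
    using N_Fq[OF ab(2)] mult_left_le_one_le[of "N x" "N \<beta>"] by (simp add: y_eq_x N_mult)
  then have "N (\<alpha> + \<beta> * y) \<le> N x"
    using N_add_le[of \<alpha> "\<beta> * y"] N_Fq[OF ab(1)] N_x by linarith
  also have "\<dots> \<le> N x ^ Suc n"
    using N_x by (intro self_le_power) auto
  finally have "N (\<xi> * (\<alpha> + \<beta> * y)) \<le> N \<xi> * N x ^ Suc n"
    unfolding N_mult by (intro mult_left_mono) auto
  then have "N (x * w') \<le> N \<xi> * N x ^ Suc n"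
    using N_diff_le[of w "\<xi> * (\<alpha> + \<beta> * y)"] Suc.prems(2) w by simp
  then have "N w' \<le> N \<xi> * N x ^ n"
    using N_x by (simp add: N_mult mult_ac)
  with w' obtain a where a: "a \<in> A" "w' = \<xi> * a"
    using Suc.IH by blast
  have "w = \<xi> * (\<alpha> + \<beta> * y + x * a)"
    using w a by (simp add: algebra_simps)
  moreover have "\<alpha> + \<beta> * y + x * a \<in> A"
    using a ab unfolding A_eq
    by (auto intro!: Fq_algebra.add Fq_algebra.mult intro: Fq_algebra.const Fq_algebra.gen)
  ultimately show ?case
    by blast
qed

theorem period_lattice_eq: "period_lattice q c = {\<xi> * a | a. a \<in> A}"
proof (intro equalityI subsetI)
  fix w
  assume "w \<in> period_lattice q c"
  then have w: "E w = 0"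
    by (simp add: period_lattice_def)
  obtain n where "N w / N \<xi> < N x ^ n"
    using real_arch_pow[OF N_x] by blast
  then have "N w \<le> N \<xi> * N x ^ n"
    by (simp add: divide_simps mult.commute)
  then show "w \<in> {\<xi> * a | a. a \<in> A}"
    using period_in_lattice[OF w] by blast
next
  fix w
  assume "w \<in> {\<xi> * a | a. a \<in> A}"
  then obtain a where "a \<in> A" "w = \<xi> * a"
    by blast
  with E_A_mult[OF _ E_xi, of a] show "w \<in> period_lattice q c"
    by (simp add: period_lattice_def mult.commute)
qed

end

section \<open>Finite fields and the main theorem\<close>

text \<open>Multiplication by a nonzero \<open>a\<close> permutes the nonzero elements, so their
  product absorbs \<open>a ^ (CARD('f) - 1)\<close>.\<close>

lemma finite_field_pow_card:
  fixes a :: "'f::{field,finite}"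
  shows "a ^ CARD('f) = a"
proof (cases "a = 0")
  case False
  let ?U = "UNIV - {0 :: 'f}"
  have "bij_betw ((*) a) ?U ?U"
    by (rule bij_betwI[where g = "\<lambda>b. b / a"]) (use False in auto)
  then have "\<Prod>?U = (\<Prod>b\<in>?U. a * b)"
    by (rule prod.reindex_bij_betw[symmetric])
  also have "\<dots> = a ^ (CARD('f) - 1) * \<Prod>?U"
    by (simp add: prod.distrib card_Diff_singleton)
  finally have "a ^ (CARD('f) - 1) = 1"
    by simp
  then show ?thesis
    using power_minus_mult[of "CARD('f)" a] by simp
qed (simp add: power_0_left)

text \<open>For \<open>e = 1\<close> the roots form \<open>Fq q\<close>; the case
  \<open>e = - 1\<close> bounds the image of \<open>a ^ q - a\<close> over a field with
  \<open>q\<^sup>2\<close> elements.\<close>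

lemma roots_pow_eq_mult:
  fixes e :: "'a::field"
  assumes "q \<ge> 2"
  shows "finite {v. v ^ q = e * v}" and "card {v. v ^ q = e * v} \<le> q"
proof -
  define p where "p = Polynomial.monom 1 q - Polynomial.monom e 1"
  have "poly.coeff p q = 1"
    using assms by (simp add: p_def)
  then have "p \<noteq> 0"
    by auto
  have "Polynomial.degree p \<le> q"
    unfolding p_def using assms by (intro degree_diff_le order.trans[OF degree_monom_le]) auto
  moreover have "{v. v ^ q = e * v} = {v. poly p v = 0}"
    by (simp add: p_def poly_monom)
  ultimately show "finite {v. v ^ q = e * v}" "card {v. v ^ q = e * v} \<le> q"
    using poly_roots_finite[OF \<open>p \<noteq> 0\<close>] card_poly_roots_bound[OF \<open>p \<noteq> 0\<close>] by auto
qed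

text \<open>
  The kernel of \<open>a \<mapsto> a\<^sup>q - a\<close> is \<open>Fq q\<close>, its image consists of roots of \<open>v\<^sup>q = - v\<close>; both have
  at most \<open>q\<close> elements, and the product of the two cardinalities is \<open>q\<^sup>2\<close>.
\<close>
lemma card_Fq_quadratic:
  assumes q: "q \<ge> 2" and card: "CARD('f::{field,finite}) = q\<^sup>2"
    and frob: "\<And>a b :: 'f. (a + b) ^ q = a ^ q + b ^ q"
  shows "card (Fq q :: 'f set) = q"
proof -
  have diff: "(a - b) ^ q = a ^ q - b ^ q" for a b :: 'f
    using frob[of "a - b" b] by (simp add: algebra_simps)
  have pow: "(a ^ q) ^ q = a" for a :: 'f
    using finite_field_pow_card[of a] by (simp add: card power2_eq_square power_mult)
  define f where "f a = a ^ q - a" for a :: 'f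
  \<comment> \<open>The pair keeps the value of \<open>f\<close> and the offset from a chosen
    preimage, from which \<open>a\<close> can be recovered.\<close>
  define g where "g a = (f a, a - inv_into UNIV f (f a))" for a :: 'f
  have inv: "f (inv_into UNIV f (f a)) = f a" for a
    by (rule f_inv_into_f) auto
  have "inj g"
    by (rule injI) (auto simp: g_def)
  moreover have "range g \<subseteq> {v. v ^ q = - 1 * v} \<times> Fq q"
  proof -
    have "f a ^ q = - f a" for a
      by (simp add: f_def diff pow)
    moreover have "a - inv_into UNIV f (f a) \<in> Fq q" for a
      using inv[of a] by (auto simp: Fq_def f_def diff algebra_simps)
    ultimately show ?thesis
      by (auto simp: g_def)
  qed
  ultimately have "CARD('f) \<le> card ({v :: 'f. v ^ q = - 1 * v} \<times> (Fq q :: 'f set))"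
    by (rule card_inj_on_le) simp
  then have "q\<^sup>2 \<le> card {v :: 'f. v ^ q = - 1 * v} * card (Fq q :: 'f set)"
    by (simp only: card card_cartesian_product)
  also have "\<dots> \<le> q * card (Fq q :: 'f set)"
    using roots_pow_eq_mult(2)[OF q, of "- 1 :: 'f"] by (rule mult_le_mono1)
  finally have "q \<le> card (Fq q :: 'f set)"
    using q by (simp add: power2_eq_square)
  moreover have "card (Fq q :: 'f set) \<le> q"
    using roots_pow_eq_mult(2)[OF q, of "1 :: 'f"] by (simp add: Fq_def)
  ultimately show ?thesis
    by simp
qed

text \<open>The characteristic divides the prime \<open>p\<close> and is not 1, so it is
  \<open>p\<close>. The hypothesis \<open>of_nat p = 0\<close> is in a form that passes along
  \<iota>.\<close>

lemma frobenius_add_of_CHAR: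
  fixes a b :: "'a::idom"
  assumes "normalization_semidom_class.prime p" "of_nat p = (0 :: 'a)" "q = p ^ k"
  shows "(a + b) ^ q = a ^ q + b ^ q"
proof -
  have "CHAR('a) dvd p"
    using assms(2) by (simp add: of_nat_eq_0_iff_char_dvd)
  then have "CHAR('a) = p"
    using assms(1) CHAR_not_1' prime_nat_iff by (metis One_nat_def)
  then show ?thesis
    using assms freshmans_dream'[of q k a b] by simp
qed

lemma twisted_eval_degree_2:
  "twisted_eval q [:a, b, c:] v = a * v + b * v ^ q + c * v ^ q\<^sup>2"
proof -
  have "twisted_eval q [:a, b, c:] v = (\<Sum>i\<le>2. poly.coeff [:a, b, c:] i * v ^ q ^ i)"
    unfolding twisted_eval_def
    by (intro sum.mono_neutral_left) (auto intro: coeff_eq_0)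
  then show ?thesis
    by (simp add: numeral_2_eq_2)
qed

theorem theorem3p13:
  fixes q :: nat
    and \<zeta> :: "'f::{field,finite}"
    and \<iota> :: "'f fls alg_closure \<Rightarrow> 'c::{field,complete_space}"
    and z zq t x y T Ts :: 'c
    and A :: "'c set"
    and \<Psi> :: "'c \<Rightarrow> 'c poly"
    and c :: "nat \<Rightarrow> 'c"
  assumes "primepow q" and "CARD('f) = q ^ 2" and "\<zeta> \<notin> Fq q"
    and "completed_alg_closure \<iota>"
    and "z = of_const \<iota> \<zeta>" and "zq = of_const \<iota> (\<zeta> ^ q)"
    and "t = zq + \<iota> (to_ac fls_X)"
    and "x = 1 / ((t - z) * (t - zq))" and "y = t / ((t - z) * (t - zq))"
    and "A = Fq_algebra q {x, y}"
    and "T = 1 / (t - zq)" and "Ts = 1 / (t - z)"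
    and "drinfeld_module q A \<Psi>" and "drinfeld_rank q A \<Psi> 1"
    and "\<Psi> x = [: x, Ts + T ^ (q - 1) * Ts, Ts / T :]"
    and "\<Psi> y = [: y, t * Ts + z * T ^ (q - 1) * Ts, z * (Ts / T) :]"
    and "drinfeld_exponential q A \<Psi> c"
  shows "convergent_prod (\<lambda>i. 1 - bracket q T Ts (i + 1) / bracket q T Ts (i + 3)) \<and>
    (\<exists>\<rho>. \<rho> ^ (q - 1) = - bracket q T Ts 2) \<and>
    (\<forall>\<rho> \<xi>. \<rho> ^ (q - 1) = - bracket q T Ts 2 \<longrightarrow>
       \<xi> = \<rho> * (Ts / T) / bracket q T Ts 1 *
           (\<Prod>i. 1 - bracket q T Ts (i + 1) / bracket q T Ts (i + 3)) \<longrightarrow>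
       period_lattice q c = {\<xi> * a | a. a \<in> A})"
proof -
  define N where "N v = dist v 0" for v :: 'c
  define u where "u = \<iota> (to_ac fls_X)"
  have \<iota>_1: "\<iota> 1 = 1"
    and \<iota>_add: "\<iota> (v + w) = \<iota> v + \<iota> w"
    and \<iota>_mult: "\<iota> (v * w) = \<iota> v * \<iota> w" for v w
    using assms(4) by (auto simp: completed_alg_closure_def)
  interpret ultrametric_field N
    by unfold_locales (use assms(4) in \<open>auto simp: completed_alg_closure_def N_def\<close>)
  have N_\<iota>: "N (\<iota> (to_ac f)) = real CARD('f) powi (- fls_subdegree f)" if "f \<noteq> 0" for f
    using assms(4) that by (auto simp: completed_alg_closure_def N_def)
  have \<iota>_0: "\<iota> 0 = 0"
    using \<iota>_add[of 0 0] by (metis add_cancel_right_left add_0)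
  have \<iota>_minus: "\<iota> (- v) = - \<iota> v" for v
    using \<iota>_add[of v "- v"] \<iota>_0 by (simp add: eq_neg_iff_add_eq_0 add.commute)
  have \<iota>_diff: "\<iota> (v - w) = \<iota> v - \<iota> w" for v w
    using \<iota>_add[of v "- w"] by (simp add: \<iota>_minus)
  have \<iota>_pow: "\<iota> (v ^ n) = \<iota> v ^ n" for v n
    by (induction n) (auto simp: \<iota>_1 \<iota>_mult)
  have \<iota>_of_nat: "\<iota> (of_nat n) = of_nat n" for n
    by (induction n) (auto simp: \<iota>_0 \<iota>_1 \<iota>_add)
  obtain p k where p: "normalization_semidom_class.prime p" "q = p ^ k"
    using assms(1) by (auto simp: primepow_def)
  have q_ge_2: "q \<ge> 2"
    using primepow_gt_Suc_0[OF assms(1)] by simp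
  have "CHAR('f) dvd p ^ (k * 2)"
    using CHAR_dvd_CARD[where ?'a = 'f] assms(2) p(2) by (simp add: power_mult)
  then have "CHAR('f) dvd p"
    using prime_CHAR_semidom[where ?'a = 'f] finite_imp_CHAR_pos[where ?'a = 'f] p(1)
    by (metis finite prime_dvd_power_nat primes_dvd_imp_eq dvd_refl)
  then have p_0: "of_nat p = (0 :: 'f)" "of_nat p = (0 :: 'f fls alg_closure)"
    by (simp_all add: of_nat_eq_0_iff_char_dvd)
  then have "of_nat p = (0 :: 'c)"
    using \<iota>_of_nat[of p] \<iota>_0 by simp
  note frob_f = frobenius_add_of_CHAR[OF p(1) p_0(1) p(2)]
    and frob_c = frobenius_add_of_CHAR[OF p(1) this p(2)]
  have const_pow: "of_const \<iota> a ^ n = of_const \<iota> (a ^ n)" for a n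
    by (simp add: of_const_def fls_const_power \<iota>_pow)
  have inj_const: "a = b" if "of_const \<iota> a = of_const \<iota> b" for a b
  proof (rule ccontr)
    assume "a \<noteq> b"
    then have "N (\<iota> (to_ac (fls_const (a - b)))) > 0"
      using assms(2) q_ge_2 by (subst N_\<iota>) (auto intro!: zero_less_power_int)
    moreover have "\<iota> (to_ac (fls_const (a - b))) = of_const \<iota> a - of_const \<iota> b"
      by (simp add: of_const_def \<iota>_diff flip: fls_minus_const)
    ultimately show False
      using that by simp
  qed
  have card_Fq: "card (Fq q :: 'c set) = q"
  proof (rule antisym)
    show "card (Fq q :: 'c set) \<le> q"
      using roots_pow_eq_mult(2)[OF q_ge_2, of "1 :: 'c"] by (simp add: Fq_def)
    \<comment> \<open>The constants embed the \<open>q\<close> elements over \<open>'f\<close> into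
      those over \<open>'c\<close>.\<close>
    have "card (Fq q :: 'f set) \<le> card (Fq q :: 'c set)"
      using roots_pow_eq_mult(1)[OF q_ge_2, of "1 :: 'c"] inj_const
      by (intro card_inj_on_le[of "of_const \<iota>"]) (auto simp: Fq_def inj_on_def const_pow)
    then show "q \<le> card (Fq q :: 'c set)"
      using card_Fq_quadratic[OF q_ge_2 assms(2) frob_f] by simp
  qed
  interpret quadratic_place N q z zq u t T Ts
  proof
    show "2 \<le> q" "(a + b) ^ q = a ^ q + b ^ q" for a b :: 'c
      using q_ge_2 frob_c by auto
    show "z ^ q = zq"
      using assms by (simp add: const_pow)
    show "zq ^ q = z"
      using assms finite_field_pow_card[of \<zeta>]
      by (simp add: const_pow power2_eq_square flip: power_mult)
    show "z \<noteq> zq"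
      using assms inj_const[of \<zeta> "\<zeta> ^ q"] by (auto simp: Fq_def)
    have "real (q\<^sup>2) > 1"
      using q_ge_2 by (simp add: power2_eq_square one_less_mult flip: of_nat_mult)
    moreover have "N u = inverse (real (q\<^sup>2))"
      using assms(2) by (simp add: u_def N_\<iota>)
    ultimately have "N u \<noteq> 0" "N u < 1"
      using q_ge_2 by (auto simp: inverse_less_1_iff simp del: of_nat_power)
    then show "u \<noteq> 0" "N u < 1"
      by auto
    show "t = zq + u" "T = 1 / (t - zq)" "Ts = 1 / (t - z)"
      using assms by (auto simp: u_def)
  qed
  have x_y: "x \<in> A" "y \<in> A"
    using assms(10) by (auto intro: Fq_algebra.gen)
  have exp: "c 0 = 1" "summable (\<lambda>j. c j * w ^ q ^ j)"
    and functional: "a \<in> A \<Longrightarrow>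
      twisted_eval q (\<Psi> a) (Fq_linear_series q c w) = Fq_linear_series q c (a * w)" for w a
    using assms(17) by (auto simp: drinfeld_exponential_def)
  interpret carlitz_exponential N q z zq u t T Ts x y c
  proof
    show "x = 1 / ((t - z) * (t - zq))" "y = t / ((t - z) * (t - zq))"
      by fact+
    show "c 0 = 1" "summable (\<lambda>j. c j * w ^ q ^ j)" for w
      by (fact exp)+
    show "T * Fq_linear_series q c w + Fq_linear_series q c w ^ q =
      Fq_linear_series q c (y * w) - z * Fq_linear_series q c (x * w)" for w
    proof -
      let ?e = "Fq_linear_series q c w"
      \<comment> \<open>This is \<open>\<Psi>\<^sub>y - \<zeta> \<Psi>\<^sub>x = T + \<tau>\<close>.\<close>
      have "Fq_linear_series q c (y * w) - z * Fq_linear_series q c (x * w) =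
          (y - z * x) * ?e + (t - z) * Ts * ?e ^ q"
        unfolding functional[OF x_y(1), symmetric] functional[OF x_y(2), symmetric]
          assms(15,16) twisted_eval_degree_2 by (simp add: algebra_simps)
      also have "y - z * x = T"
        using t_neq_const by (simp add: assms(8,9,11) divide_simps)
      also have "(t - z) * Ts = 1"
        using t_neq_const by (simp add: assms(12))
      finally show ?thesis
        by simp
    qed
  qed
  obtain P where P: "carlitz_factor has_prod P" "(\<lambda>n. \<Prod>i<n. carlitz_factor i) \<longlonglongrightarrow> P" "N P = 1"
    using has_prod_carlitz_factor by blast
  have P_eq: "prodinf carlitz_factor = P"
    using has_prod_unique[OF P(1)] by simp
  show ?thesis
  proof (intro conjI allI impI)
    \<comment> \<open>\<open>N P = 1\<close> excludes the alternative in \<open>has_prod\<close>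
      where the product is 0.\<close>
    have "raw_has_prod carlitz_factor 0 P"
      using P by (auto simp: has_prod_def)
    then show "convergent_prod carlitz_factor"
      by (auto simp: convergent_prod_def)
  next
    \<comment> \<open>\<open>T\<close> lies in the image of \<iota>, so the root of
      \<open>- bracket q T Ts 2\<close> can be taken in the algebraic closure and mapped
      over.\<close>
    have "T * u = 1"
      using u_nonzero by (simp add: T_inverse)
    moreover have "\<iota> (to_ac (inverse fls_X)) * u = 1"
      unfolding u_def \<iota>_mult[symmetric] to_ac_mult[symmetric] by (simp add: \<iota>_1)
    ultimately have "T = \<iota> (to_ac (inverse fls_X))"
      by (metis u_nonzero mult_right_cancel)
    then obtain v where v: "T = \<iota> v"
      by blast
    obtain s where "s ^ (q - 1) = - (v ^ q\<^sup>2 - v)"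
      using nth_root_exists[of "q - 1"] q_ge_2 by auto
    then have "\<iota> s ^ (q - 1) = - bracket q T Ts 2"
      by (simp add: bracket_def v \<iota>_diff \<iota>_minus flip: \<iota>_pow)
    then show "\<exists>\<rho>. \<rho> ^ (q - 1) = - bracket q T Ts 2"
      by blast
  next
    fix \<rho> \<xi>
    assume \<rho>: "\<rho> ^ (q - 1) = - bracket q T Ts 2"
      and \<xi>: "\<xi> = \<rho> * (Ts / T) / bracket q T Ts 1 * prodinf carlitz_factor"
    \<comment> \<open>\<open>D\<close> collects the part of \<open>\<xi> ^ (q - 1)\<close> without
      \<rho> and the powers of \<open>T\<close>; the rest is matched with the limit in
      \<open>tendsto_W_0\<close>.\<close>
    define D where "D = (Ts / bracket q T Ts 1 * P) ^ (q - 1)"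
    have pow_q: "T ^ q = T ^ (q - 1) * T"
      using power_minus_mult[of q T] q_ge_2 by simp
    have "\<xi> = \<rho> * (Ts / bracket q T Ts 1 * P) / T"
      unfolding \<xi> P_eq by (simp add: mult_ac)
    then have "\<xi> ^ (q - 1) = \<rho> ^ (q - 1) * D / T ^ (q - 1)"
      by (simp only: D_def power_mult_distrib power_divide)
    then have "- (\<xi> ^ (q - 1)) / T = bracket q T Ts 2 * D / (T ^ (q - 1) * T)"
      unfolding \<rho> by simp
    also have "\<dots> = (T ^ q) ^ (q - 1) * D * (bracket q T Ts 2 / ((T ^ q) ^ (q - 1) * T ^ q))"
      using pow_q by simp
    also have "(T ^ q) ^ (q - 1) * T ^ q = T ^ q\<^sup>2"
      using power_minus_mult[of q "T ^ q"] q_ge_2 by (simp add: power2_eq_square flip: power_mult)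
    also have "(T ^ q) ^ (q - 1) * D = (T ^ q * Ts / bracket q T Ts 1 * P) ^ (q - 1)"
      by (simp add: D_def mult.assoc flip: power_mult_distrib)
    finally have limit: "(\<lambda>n. W n 0 ^ (q - 1)) \<longlonglongrightarrow> - (\<xi> ^ (q - 1)) / T"
      using tendsto_W_0[OF P(2)] by simp
    interpret carlitz_lattice N q z zq u t T Ts x y c \<xi> A "Ts + T ^ (q - 1) * Ts"
    proof
      show "(\<lambda>n. W n 0 ^ (q - 1)) \<longlonglongrightarrow> - (\<xi> ^ (q - 1)) / T"
        by (fact limit)
      show "A = Fq_algebra q {x, y}" "card (Fq q :: 'c set) = q"
        by fact+
      show "E (x * w) = x * E w + (Ts + T ^ (q - 1) * Ts) * E w ^ q + Ts / T * E w ^ q\<^sup>2" for w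
        using functional[OF x_y(1), of w] by (simp add: assms(15) twisted_eval_degree_2)
      show "E (a * w) = 0" if "a \<in> A" "E w = 0" for a w
        using functional[OF that(1), of w] that(2) gr_implies_not0[OF q_pos]
        by (simp add: twisted_eval_def power_0_left)
    qed
    show "period_lattice q c = {\<xi> * a | a. a \<in> A}"
      by (rule period_lattice_eq)
  qed
qed

end
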